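(* The process $(X(t))_{t\ge 0}$, $X(t)=(Q(t),Mp(t))^\top$, which satisfies $$dX(t)=BX(t)\,dt+\begin{bmatrix}0\\ \sigma M\end{bmatrix}dW(t),\qquad X(0)=(Q_0,Mp_0)^\top,$$ converges for $t\to\infty$ in distribution to a normal distribution with expectation $$\mu_X(\infty)=\begin{bmatrix}\frac{L}{N}\mathbf{1}\\0\end{bmatrix}\in\mathbb{R}^{2N}$$ and covariance matrix $$\Sigma_X(\infty)=\begin{bmatrix}\frac{\sigma^2}{2\alpha^2\beta}K&0\\0&\frac{\sigma^2}{2\beta}K\end{bmatrix}\in\mathbb{R}^{2N\times 2N}.$$
   Context: $N\ge3$ is an integer, $L>0$, $\alpha,\beta\in(0,\infty)$, $\sigma\in\mathbb{R}$, and $W$ is an $N$-dimensional standard Brownian motion. $\mathbf{1}=(1,\dots,1)^\top\in\mathbb{R}^N$ and $I$ is the $N\times N$ identity matrix. $A\in\mathbb{R}^{N\times N}$ is the circulant matrix with $A_{n,n}=-1$ for all $n$, $A_{n,n+1}=1$ for $n\in\{1,\dots,N-1\}$, $A_{N,1}=1$, and all other entries $0$. $$B=\begin{bmatrix}0&A\\-\alpha^2A^\top&-\beta A^\top A\end{bmatrix}\in\mathbb{R}^{2N\times2N},\qquad G=\begin{bmatrix}0\\ \sigma I\end{bmatrix}\in\mathbb{R}^{2N\times N}.$$ $Z(t)=(Q(t),p(t))^\top\in\mathbb{R}^{2N}$ is the solution of the linear SDE $dZ(t)=BZ(t)\,dt+G\,dW(t)$ with deterministic initial value $Z(0)=(Q_0,p_0)^\top$,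 where $Q_0\in[0,\infty)^N$ satisfies $\sum_{n=1}^N(Q_0)_n=L$ and $p_0\in\mathbb{R}^N$. $M=I-\frac1N\mathbf{1}\mathbf{1}^\top\in\mathbb{R}^{N\times N}$, so that $Mp(t)$ is the vector of deviations of the velocities from their mean. With $\omega=e^{2\pi \mathrm{i}/N}$, $v_j=\frac{1}{\sqrt N}(1,\omega^j,\omega^{2j},\dots,\omega^{(N-1)j})^\top\in\mathbb{C}^N$ and $\mu_j=2-2\cos(2\pi j/N)$, the matrix $K$ is $K=\sum_{j=1}^{N-1}\frac{v_jv_j^*}{\mu_j}\in\mathbb{C}^{N\times N}$, where $^*$ denotes conjugate transpose. Normal distributions are allowed to be degenerate. *)

theory Defs
  imports "HOL-Probability.Probability"
begin

text \<open>
  Vectors of length \<open>N\<close> are elements of \<open>real ^ 'n\<close> with \<open>N = CARD('n)\<close>, and vectors of length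
  \<open>2 * N\<close> are elements of \<open>real ^ ('n + 'n)\<close>.  Where the order of the indices matters, a numbering
  \<open>\<iota>\<close> of \<open>'n\<close>, i.e. a bijection onto \<open>{1..N}\<close>, is passed as an argument.
\<close>

section \<open>Block vectors and matrices\<close>

definition stack :: "'a ^ 'm \<Rightarrow> 'a ^ 'n \<Rightarrow> 'a ^ ('m::finite + 'n::finite)" where
  "stack u v = (\<chi> i. case i of Inl k \<Rightarrow> u $ k | Inr k \<Rightarrow> v $ k)"

text \<open>
  A matrix is the vector of its rows, so \<open>stack\<close> also places one matrix on top of another.
\<close>

definition block_mat ::
  "'a ^ 'k ^ 'm \<Rightarrow> 'a ^ 'l ^ 'm \<Rightarrow> 'a ^ 'k ^ 'n \<Rightarrow> 'a ^ 'l ^ 'n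
    \<Rightarrow> 'a ^ ('k::finite + 'l::finite) ^ ('m::finite + 'n::finite)" where
  "block_mat S T U V =
     stack (\<chi> i. stack (S $ i) (T $ i)) (\<chi> i. stack (U $ i) (V $ i))"

section \<open>The coefficient matrices\<close>

definition circ_A :: "('n::finite \<Rightarrow> nat) \<Rightarrow> real ^ 'n ^ 'n" where
  "circ_A \<iota> = (\<chi> m n.
     if n = m then -1
     else if \<iota> n = \<iota> m + 1 \<or> (\<iota> m = CARD('n) \<and> \<iota> n = 1) then 1
     else 0)"

definition drift_B :: "('n::finite \<Rightarrow> nat) \<Rightarrow> real \<Rightarrow> real \<Rightarrow> real ^ ('n + 'n) ^ ('n + 'n)" where
  "drift_B \<iota> \<alpha> \<beta> = block_mat
     0                                       (circ_A \<iota>)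
     (- (\<alpha>\<^sup>2 *\<^sub>R transpose (circ_A \<iota>)))  (- (\<beta> *\<^sub>R (transpose (circ_A \<iota>) ** circ_A \<iota>)))"

definition diffusion_G :: "real \<Rightarrow> real ^ 'n ^ ('n::finite + 'n)" where
  "diffusion_G \<sigma> = stack 0 (\<sigma> *\<^sub>R mat 1)"

definition centering_M :: "real ^ 'n ^ 'n::finite" where
  "centering_M = mat 1 - (1 / real CARD('n)) *\<^sub>R (\<chi> m n. 1)"

definition fourier_vec :: "('n::finite \<Rightarrow> nat) \<Rightarrow> nat \<Rightarrow> complex ^ 'n" where
  "fourier_vec \<iota> j = (\<chi> n.
     exp (2 * of_real pi * \<i> / of_nat CARD('n)) ^ ((\<iota> n - 1) * j) / of_real (sqrt (real CARD('n))))"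

definition eig_mu :: "nat \<Rightarrow> nat \<Rightarrow> real" where
  "eig_mu N j = 2 - 2 * cos (2 * pi * real j / real N)"

definition mat_K :: "('n::finite \<Rightarrow> nat) \<Rightarrow> complex ^ 'n ^ 'n" where
  "mat_K \<iota> = (\<Sum>j = 1..CARD('n) - 1.
     (1 / eig_mu CARD('n) j) *\<^sub>R (\<chi> m n. fourier_vec \<iota> j $ m * cnj (fourier_vec \<iota> j $ n)))"

section \<open>Normal distributions and convergence in distribution\<close>

text \<open>
  The normal distribution on the line with expectation \<open>m\<close> and standard deviation \<open>s \<ge> 0\<close>.
  The case \<open>s = 0\<close> has to be separated because \<open>normal_density m 0\<close> is identically zero.
\<close>

definition normal_real :: "real \<Rightarrow> real \<Rightarrow> real measure" where
  "normal_real m s =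
     (if s = 0 then return borel m else density lborel (\<lambda>x. ennreal (normal_density m s x)))"

text \<open>
  A possibly degenerate multivariate normal distribution: every linear functional is normal.
\<close>

definition normal_law :: "(real ^ 'd::finite) measure \<Rightarrow> bool" where
  "normal_law \<nu> \<longleftrightarrow> prob_space \<nu> \<and> sets \<nu> = sets borel \<and>
     (\<forall>u. \<exists>m s. 0 \<le> s \<and> distr \<nu> borel (\<lambda>x. u \<bullet> x) = normal_real m s)"

definition mean_vec :: "(real ^ 'd::finite) measure \<Rightarrow> real ^ 'd" where
  "mean_vec \<nu> = (\<integral>x. x \<partial>\<nu>)"

definition cov_mat :: "(real ^ 'd::finite) measure \<Rightarrow> real ^ 'd ^ 'd" where
  "cov_mat \<nu> = (\<chi> i j. \<integral>x. (x $ i - mean_vec \<nu> $ i) * (x $ j - mean_vec \<nu> $ j) \<partial>\<nu>)"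

text \<open>
  Convergence in distribution as \<open>t \<rightarrow> \<infinity>\<close>; the library's \<open>weak_conv_m\<close> covers only sequences of
  measures on the real line.
\<close>

definition converges_in_distribution ::
  "'w measure \<Rightarrow> (real \<Rightarrow> 'w \<Rightarrow> 'a::topological_space) \<Rightarrow> 'a measure \<Rightarrow> bool" where
  "converges_in_distribution P X \<nu> \<longleftrightarrow>
     (\<forall>f :: 'a \<Rightarrow> real. continuous_on UNIV f \<and> bounded (range f) \<longrightarrow>
        ((\<lambda>t. \<integral>y. f y \<partial>(distr P borel (X t))) \<longlongrightarrow> (\<integral>y. f y \<partial>\<nu>)) at_top)"

section \<open>Brownian motion and linear SDEs with additive noise\<close>

text \<open>Processes are indexed by \<open>real\<close>, but only times \<open>t \<ge> 0\<close> are ever constrained.\<close>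

definition real_brownian_motion :: "'w measure \<Rightarrow> (real \<Rightarrow> 'w \<Rightarrow> real) \<Rightarrow> bool" where
  "real_brownian_motion P w \<longleftrightarrow> prob_space P \<and>
     (\<forall>t\<ge>0. w t \<in> borel_measurable P) \<and>
     (AE \<omega> in P. w 0 \<omega> = 0) \<and>
     (AE \<omega> in P. continuous_on {0..} (\<lambda>t. w t \<omega>)) \<and>
     (\<forall>(k::nat) \<tau>. 0 \<le> \<tau> 0 \<and> (\<forall>i<k. \<tau> i < \<tau> (Suc i)) \<longrightarrow>
        prob_space.indep_vars P (\<lambda>_. borel) (\<lambda>i \<omega>. w (\<tau> (Suc i)) \<omega> - w (\<tau> i) \<omega>) {..<k}) \<and>
     (\<forall>s t. 0 \<le> s \<and> s < t \<longrightarrow>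
        distr P borel (\<lambda>\<omega>. w t \<omega> - w s \<omega>) = normal_real 0 (sqrt (t - s)))"

text \<open>
  The components are independent as processes, i.e. as random elements of the space of functions
  on \<open>{0..}\<close> with the product \<open>\<sigma>\<close>-algebra.
\<close>

definition brownian_motion :: "'w measure \<Rightarrow> (real \<Rightarrow> 'w \<Rightarrow> real ^ 'n::finite) \<Rightarrow> bool" where
  "brownian_motion P W \<longleftrightarrow>
     (\<forall>n. real_brownian_motion P (\<lambda>t \<omega>. W t \<omega> $ n)) \<and>
     prob_space.indep_vars P (\<lambda>_. PiM {0..} (\<lambda>_. borel))
       (\<lambda>n \<omega>. \<lambda>t\<in>{0..}. W t \<omega> $ n) UNIV"

text \<open>
  The process \<open>Z\<close> solves \<open>dZ(t) = B Z(t) dt + G dW(t)\<close>, \<open>Z(0) = z\<^sub>0\<close>.  Since \<open>G\<close> is constant and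
  \<open>W(0) = 0\<close>, the stochastic integral of \<open>G\<close> over \<open>[0,t]\<close> is \<open>G W(t)\<close>, so the integral form of the
  equation is a pathwise one.  Adaptedness is not demanded: the pathwise equation has a unique
  continuous solution, which up to null sets is a functional of the path of \<open>W\<close> on \<open>[0,t]\<close>.
\<close>

definition solves_linear_sde ::
  "'w measure \<Rightarrow> real ^ 'd ^ 'd \<Rightarrow> real ^ 'n ^ 'd \<Rightarrow> (real \<Rightarrow> 'w \<Rightarrow> real ^ 'n::finite)
    \<Rightarrow> real ^ 'd \<Rightarrow> (real \<Rightarrow> 'w \<Rightarrow> real ^ 'd::finite) \<Rightarrow> bool" where
  "solves_linear_sde P B G W z\<^sub>0 Z \<longleftrightarrow>
     (\<forall>t\<ge>0. Z t \<in> borel_measurable P) \<and>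
     (AE \<omega> in P. continuous_on {0..} (\<lambda>t. Z t \<omega>) \<and>
        (\<forall>t\<ge>0. Z t \<omega> = z\<^sub>0 + integral {0..t} (\<lambda>s. B *v Z s \<omega>) + G *v W t \<omega>))"

end

theory Submission
  imports Defs
begin

text \<open>
  For a vector \<open>u\<close>, let \<open>\<eta>\<close> solve the adjoint equation \<open>\<eta>' = B\<^sup>T \<eta>\<close>, \<open>\<eta> 0 = u\<close>.  Pathwise,
  \<open>u \<bullet> X T = \<eta> T \<bullet> X 0 + \<integral> G\<^sup>T \<eta> (T - s) dW(s)\<close> is a limit of sums of independent increments, hence
  normal.  The block diagonal \<open>\<Sigma>\<close> built from \<open>K\<close> solves the Lyapunov equation
  \<open>B \<Sigma> + \<Sigma> B\<^sup>T + G G\<^sup>T = 0\<close> with \<open>G = stack 0 (\<sigma> M)\<close>, so the variance is \<open>u \<bullet> \<Sigma> u - \<eta> T \<bullet> \<Sigma> (\<eta> T)\<close>.  The adjoint flow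
  decays on mean-zero vectors and preserves the mean of the first block, which gives convergence of
  all characteristic functions, and the theorem follows from a multivariate Levy continuity theorem.
\<close>

section \<open>Normal distributions on the line\<close>

text \<open>The drift matrix is singular: vectors that are constant in each block lie in the kernel
  of its transpose, so the adjoint flow cannot decay everywhere. The constant direction of
  \<open>Q\<close> is harmless, because it carries no noise and the total length is conserved; it
  alone survives in the limiting mean. The constant direction of \<open>p\<close> would diffuse with
  growing variance when \<sigma> is nonzero; centering removes it from the initial value and from
  the noise. \<open>K\<close> is the pseudo-inverse of \<open>transpose A ** A\<close>: it kills
  constants, and multiplying the two gives the projection \<open>M\<close>, which is what the noise
  term of the Lyapunov equation asks for. The weight 1 / \<alpha>^2 in the upper block makes the two
  coupling terms of that equation cancel. Since the variance is an exact primitive along the flow,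
  neither the exponential nor the eigenvalues of the drift are computed; mere decay suffices. Decay
  is still not immediate, because friction acts on one block only and reaches the other through the
  coupling. The limit law has no density, its covariance being singular; working with linear
  functionals treats this case like any other.\<close>

lemma normal_real_eq_distr:
  assumes "0 \<le> s"
  shows "normal_real m s = distr std_normal_distribution borel (\<lambda>x. m + s * x)"
proof (cases "s = 0")
  case True
  interpret real_distribution std_normal_distribution by (rule real_dist_normal_dist)
  show ?thesis using True by (simp add: normal_real_def distr_const)
next
  case False
  interpret real_distribution std_normal_distribution by (rule real_dist_normal_dist)
  have "distributed std_normal_distribution lborel (\<lambda>x. x) std_normal_density"
    by (auto simp: distributed_def distr_id2 cong: distr_cong)
  then have "distributed std_normal_distribution lborel (\<lambda>x. m + s * x) (normal_density (m + s * 0) (\<bar>s\<bar> * 1))"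
    by (rule normal_density_affine) (use False in auto)
  then have "distr std_normal_distribution lborel (\<lambda>x. m + s * x) = density lborel (normal_density m s)"
    using assms by (simp add: distributed_def)
  moreover have "distr std_normal_distribution lborel (\<lambda>x. m + s * x) = distr std_normal_distribution borel (\<lambda>x. m + s * x)"
    by (rule distr_cong) auto
  ultimately show ?thesis using False by (simp add: normal_real_def)
qed

lemma real_distribution_normal_real: "0 \<le> s \<Longrightarrow> real_distribution (normal_real m s)"
proof -
  assume "0 \<le> s"
  interpret real_distribution std_normal_distribution by (rule real_dist_normal_dist)
  show ?thesis unfolding normal_real_eq_distr[OF \<open>0 \<le> s\<close>] by (rule real_distribution_distr) simp
qed

text \<open>The representation as an affine image of a standard normal variable covers
  \<open>s = 0\<close>, so no case distinction is needed.\<close>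

lemma char_normal_real:
  assumes "0 \<le> s"
  shows "char (normal_real m s) t = iexp (t * m) * of_real (exp (- (t * s)\<^sup>2 / 2))"
proof -
  have "char (normal_real m s) t = (\<integral>x. iexp (t * (m + s * x)) \<partial>std_normal_distribution)"
    unfolding char_def normal_real_eq_distr[OF assms] by (subst integral_distr) auto
  also have "\<dots> = (\<integral>x. iexp (t * m) * iexp ((t * s) * x) \<partial>std_normal_distribution)"
    by (intro Bochner_Integration.integral_cong) (auto simp: algebra_simps exp_add[symmetric])
  also have "\<dots> = iexp (t * m) * char std_normal_distribution (t * s)"
    unfolding char_def by (subst integral_mult_right_zero) simp
  finally show ?thesis by (simp add: char_std_normal_distribution)
qed

lemma normal_real_moments:
  assumes "0 \<le> s"
  shows "has_bochner_integral (normal_real m s) (\<lambda>x. x) m"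
    and "has_bochner_integral (normal_real m s) (\<lambda>x. (x - m)\<^sup>2) (s\<^sup>2)"
proof -
  interpret real_distribution std_normal_distribution by (rule real_dist_normal_dist)
  have i1: "integrable std_normal_distribution (\<lambda>x. x)" "(\<integral>x. x \<partial>std_normal_distribution) = 0"
    using integrable_std_normal_distribution_moment[of 1] integral_std_normal_distribution_moment_odd[of 1]
    by simp_all
  have i2: "integrable std_normal_distribution (\<lambda>x. x\<^sup>2)" "(\<integral>x. x\<^sup>2 \<partial>std_normal_distribution) = 1"
    using integrable_std_normal_distribution_moment[of 2] std_normal_distribution_even_moments(1)[of 1]
    by simp_all
  have "has_bochner_integral std_normal_distribution (\<lambda>x. m + s * x) m"
    unfolding has_bochner_integral_iff using i1 prob_space by auto
  then show "has_bochner_integral (normal_real m s) (\<lambda>x. x) m"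
    unfolding normal_real_eq_distr[OF assms] by (intro has_bochner_integral_distr) auto
  have "has_bochner_integral std_normal_distribution (\<lambda>x. (m + s * x - m)\<^sup>2) (s\<^sup>2)"
    unfolding has_bochner_integral_iff using i2 by (auto simp: power_mult_distrib)
  then show "has_bochner_integral (normal_real m s) (\<lambda>x. (x - m)\<^sup>2) (s\<^sup>2)"
    unfolding normal_real_eq_distr[OF assms] by (intro has_bochner_integral_distr) auto
qed

lemma (in prob_space) distr_mult_normal_real:
  assumes [measurable]: "X \<in> borel_measurable M" and "0 \<le> s" and "distr M borel X = normal_real m s"
  shows "distr M borel (\<lambda>\<omega>. c * X \<omega>) = normal_real (c * m) (\<bar>c\<bar> * s)"
proof (rule Levy_uniqueness)
  show "char (distr M borel (\<lambda>\<omega>. c * X \<omega>)) = char (normal_real (c * m) (\<bar>c\<bar> * s))"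
  proof
    fix t
    have "char (distr M borel (\<lambda>\<omega>. c * X \<omega>)) t = char (distr M borel X) (c * t)"
      unfolding char_def by (simp add: integral_distr mult_ac)
    then show "char (distr M borel (\<lambda>\<omega>. c * X \<omega>)) t = char (normal_real (c * m) (\<bar>c\<bar> * s)) t"
      using assms by (simp add: char_normal_real mult_ac power_mult_distrib)
  qed
qed (use assms in \<open>auto intro!: real_distribution_normal_real\<close>)

lemma (in prob_space) distr_add_normal_real:
  assumes [measurable]: "X \<in> borel_measurable M" and "0 \<le> s" and "distr M borel X = normal_real m s"
  shows "distr M borel (\<lambda>\<omega>. c + X \<omega>) = normal_real (c + m) s"
proof -
  have "distr M borel (\<lambda>\<omega>. c + X \<omega>) = distr (distr M borel X) borel (\<lambda>x. c + x)"
    by (simp add: distr_distr comp_def)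
  also have "\<dots> = normal_real (c + m) s"
    using assms(2) by (simp add: assms(3) normal_real_eq_distr distr_distr comp_def add_ac)
  finally show ?thesis .
qed

lemma (in prob_space) distr_sum_normal_real:
  assumes indep: "indep_vars (\<lambda>_. borel) X I" and "finite I"
    and s: "\<And>i. i \<in> I \<Longrightarrow> 0 \<le> s i"
    and X: "\<And>i. i \<in> I \<Longrightarrow> distr M borel (X i) = normal_real (m i) (s i)"
  shows "distr M borel (\<lambda>\<omega>. \<Sum>i\<in>I. X i \<omega>) = normal_real (\<Sum>i\<in>I. m i) (sqrt (\<Sum>i\<in>I. (s i)\<^sup>2))"
proof (rule Levy_uniqueness)
  have [measurable]: "X i \<in> borel_measurable M" if "i \<in> I" for i
    using indep that by (auto simp: indep_vars_def)
  show "real_distribution (distr M borel (\<lambda>\<omega>. \<Sum>i\<in>I. X i \<omega>))" by simp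
  show "real_distribution (normal_real (\<Sum>i\<in>I. m i) (sqrt (\<Sum>i\<in>I. (s i)\<^sup>2)))"
    by (intro real_distribution_normal_real) (simp add: sum_nonneg)
  show "char (distr M borel (\<lambda>\<omega>. \<Sum>i\<in>I. X i \<omega>)) = char (normal_real (\<Sum>i\<in>I. m i) (sqrt (\<Sum>i\<in>I. (s i)\<^sup>2)))"
  proof
    fix t
    have "char (distr M borel (\<lambda>\<omega>. \<Sum>i\<in>I. X i \<omega>)) t = (\<Prod>i\<in>I. char (distr M borel (X i)) t)"
      using indep by (rule char_distr_sum)
    also have "\<dots> = (\<Prod>i\<in>I. exp (\<i> * complex_of_real (t * m i) + complex_of_real (- (t * s i)\<^sup>2 / 2)))"
      by (intro prod.cong refl) (simp only: X s char_normal_real exp_add exp_of_real)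
    also have "\<dots> = exp (\<Sum>i\<in>I. \<i> * complex_of_real (t * m i) + complex_of_real (- (t * s i)\<^sup>2 / 2))"
      using \<open>finite I\<close> by (rule exp_sum[symmetric])
    also have "(\<Sum>i\<in>I. \<i> * complex_of_real (t * m i) + complex_of_real (- (t * s i)\<^sup>2 / 2))
       = \<i> * complex_of_real (t * (\<Sum>i\<in>I. m i)) + complex_of_real (- (t * sqrt (\<Sum>i\<in>I. (s i)\<^sup>2))\<^sup>2 / 2)"
      by (simp add: sum.distrib sum_subtractf sum_distrib_left sum_divide_distrib sum_negf sum_nonneg power_mult_distrib)
    also have "exp \<dots> = char (normal_real (\<Sum>i\<in>I. m i) (sqrt (\<Sum>i\<in>I. (s i)\<^sup>2))) t"
      by (subst char_normal_real) (simp_all only: exp_add exp_of_real real_sqrt_ge_zero sum_nonneg zero_le_power2)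
    finally show "char (distr M borel (\<lambda>\<omega>. \<Sum>i\<in>I. X i \<omega>)) t = \<dots>" .
  qed
qed

text \<open>Dominated convergence carries the bounded characteristic functions to the limit. The
  variance of a stochastic integral is obtained in this way from those of its approximating
  sums.\<close>

lemma (in prob_space) distr_normal_real_AE_limit:
  assumes S[measurable]: "\<And>n. S n \<in> borel_measurable M" and Y[measurable]: "Y \<in> borel_measurable M"
    and lim: "AE \<omega> in M. (\<lambda>n. S n \<omega>) \<longlonglongrightarrow> Y \<omega>"
    and distr: "\<And>n. distr M borel (S n) = normal_real m (sqrt (v n))" and v: "\<And>n. 0 \<le> v n"
    and v_lim: "v \<longlonglongrightarrow> V"
  shows "distr M borel Y = normal_real m (sqrt V)"
proof (rule Levy_uniqueness)
  have V: "0 \<le> V" using v v_lim by (intro LIMSEQ_le_const) auto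
  show "real_distribution (normal_real m (sqrt V))"
    using V by (intro real_distribution_normal_real) simp
  show "char (distr M borel Y) = char (normal_real m (sqrt V))"
  proof
    fix t
    have "(\<lambda>n. \<integral>\<omega>. iexp (t * S n \<omega>) \<partial>M) \<longlonglongrightarrow> (\<integral>\<omega>. iexp (t * Y \<omega>) \<partial>M)"
    proof (rule integral_dominated_convergence[where w = "\<lambda>_. 1"])
      show "AE \<omega> in M. (\<lambda>n. iexp (t * S n \<omega>)) \<longlonglongrightarrow> iexp (t * Y \<omega>)"
        using lim by eventually_elim (intro tendsto_intros)
    qed auto
    then have "(\<lambda>n. char (distr M borel (S n)) t) \<longlonglongrightarrow> char (distr M borel Y) t"
      by (simp add: char_def integral_distr)
    moreover have "char (distr M borel (S n)) t = iexp (t * m) * of_real (exp (- (t\<^sup>2 * v n) / 2))" for n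
      using v[of n] by (simp add: distr char_normal_real power_mult_distrib)
    moreover have "(\<lambda>n. iexp (t * m) * of_real (exp (- (t\<^sup>2 * v n) / 2)))
        \<longlonglongrightarrow> iexp (t * m) * of_real (exp (- (t\<^sup>2 * V) / 2))"
      by (intro tendsto_intros v_lim) auto
    ultimately have "char (distr M borel Y) t = iexp (t * m) * of_real (exp (- (t\<^sup>2 * V) / 2))"
      by (simp add: LIMSEQ_unique)
    then show "char (distr M borel Y) t = char (normal_real m (sqrt V)) t"
      using V by (simp add: char_normal_real power_mult_distrib)
  qed
qed simp

section \<open>Levy continuity in several dimensions\<close>

text \<open>Frequencies are arbitrary vectors, with no common period. By linearity, convergence of
  characteristic functions transfers to the integral of every such function.\<close>

inductive trig_poly :: "('a::euclidean_space \<Rightarrow> complex) \<Rightarrow> bool" where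
  monom: "trig_poly (\<lambda>x. c * iexp (u \<bullet> x))"
| add: "trig_poly f \<Longrightarrow> trig_poly g \<Longrightarrow> trig_poly (\<lambda>x. f x + g x)"

lemma trig_poly_mult:
  assumes "trig_poly f" "trig_poly g"
  shows "trig_poly (\<lambda>x. f x * g x)"
  using assms
proof (induction f)
  case (monom c u)
  then show ?case
  proof (induction g)
    case (monom d v)
    have "(\<lambda>x. c * iexp (u \<bullet> x) * (d * iexp (v \<bullet> x))) = (\<lambda>x. (c * d) * iexp ((u + v) \<bullet> x))"
      by (simp add: fun_eq_iff inner_add_left algebra_simps exp_add)
    then show ?case by (simp only: trig_poly.monom)
  next
    case (add g h)
    then show ?case by (simp add: distrib_left trig_poly.add)
  qed
next
  case (add f h)
  then show ?case by (simp add: distrib_right trig_poly.add)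
qed

lemma trig_poly_const: "trig_poly (\<lambda>x. c)"
  using trig_poly.monom[of c 0] by simp

lemma trig_poly_sin: "trig_poly (\<lambda>x::real^'d::finite. complex_of_real (sin (c * x $ i)))"
proof -
  have "(\<lambda>x::real^'d. complex_of_real (sin (c * x $ i)))
    = (\<lambda>x. (- \<i> / 2) * iexp (axis i c \<bullet> x) + (\<i> / 2) * iexp (axis i (- c) \<bullet> x))"
    by (simp add: fun_eq_iff inner_axis' sin_of_real[symmetric] sin_exp_eq algebra_simps exp_minus diff_divide_distrib)
  then show ?thesis by (simp only: trig_poly.intros)
qed

lemma trig_poly_sum: "finite I \<Longrightarrow> (\<And>i. i \<in> I \<Longrightarrow> trig_poly (f i)) \<Longrightarrow> trig_poly (\<lambda>x. \<Sum>i\<in>I. f i x)"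
  by (induction I rule: finite_induct) (auto intro: trig_poly_const trig_poly.add)

text \<open>A sine is a sum of two exponentials and trigonometric polynomials are closed under
  products, so only the linear generators need work: they are expanded in coordinates.\<close>

lemma trig_poly_of_polynomial:
  assumes "real_polynomial_function p"
  shows "trig_poly (\<lambda>x::real^'d::finite. complex_of_real (p (\<chi> i. sin (c * x $ i))))"
  using assms
proof (induction p)
  case (linear f)
  have expand: "f y = (\<Sum>i\<in>UNIV. f (axis i 1) * y $ i)" for y :: "real^'d"
  proof -
    have "f y = f (\<Sum>i\<in>UNIV. y $ i *\<^sub>R axis i 1)"
      using basis_expansion[of y] by (simp add: scalar_mult_eq_scaleR)
    also have "\<dots> = (\<Sum>i\<in>UNIV. f (axis i 1) * y $ i)"
      using linear by (simp add: bounded_linear.linear linear_sum linear_scale mult_ac)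
    finally show ?thesis .
  qed
  have "(\<lambda>x. complex_of_real (f (\<chi> i. sin (c * x $ i))))
      = (\<lambda>x. \<Sum>i\<in>UNIV. complex_of_real (f (axis i 1)) * complex_of_real (sin (c * x $ i)))"
    by (subst expand) simp
  then show ?case
    by (simp only:) (intro trig_poly_sum trig_poly_mult trig_poly_const trig_poly_sin finite)
qed (auto intro: trig_poly_const trig_poly.add trig_poly_mult)

lemma trig_poly_integrable:
  assumes "trig_poly g" and "prob_space \<mu>" and "sets \<mu> = sets borel"
  shows "integrable \<mu> g"
  using assms(1)
proof induction
  case (monom c u)
  interpret prob_space \<mu> by fact
  have [measurable_cong]: "sets \<mu> = sets borel" by fact
  show ?case by (intro integrable_const_bound[where B = "norm c"]) (auto simp: norm_mult)
qed auto

lemma trig_poly_integral_tendsto: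
  assumes "trig_poly g"
    and \<mu>: "\<And>n. prob_space (\<mu> n)" "\<And>n. sets (\<mu> n) = sets borel"
    and \<nu>: "prob_space \<nu>" "sets \<nu> = sets borel"
    and conv: "\<And>u. ((\<lambda>n. \<integral>x. iexp (u \<bullet> x) \<partial>\<mu> n) \<longlongrightarrow> (\<integral>x. iexp (u \<bullet> x) \<partial>\<nu>)) F"
  shows "((\<lambda>n. \<integral>x. g x \<partial>\<mu> n) \<longlongrightarrow> (\<integral>x. g x \<partial>\<nu>)) F"
  using assms(1)
proof induction
  case (monom c u)
  show ?case unfolding integral_mult_right_zero by (intro tendsto_intros conv)
next
  case (add f g)
  then show ?case
    by (simp add: trig_poly_integrable \<mu> \<nu>) (intro tendsto_intros)
qed

text \<open>
  On the cube \<open>\<bar>x\<^sub>i\<bar> \<le> k + 1\<close>, \<open>f\<close> agrees with its periodic extension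
  \<open>f (arcsin (sin (c x\<^sub>i)) / c)\<^sub>i\<close>, which is a continuous function of the \<open>sin (c x\<^sub>i)\<close> and hence
  uniformly close on the whole space to a trigonometric polynomial.  The mass outside the cube is
  controlled by the cutoffs \<open>h k\<close> and the one-dimensional continuity theorem.
\<close>

theorem levy_continuity_vec:
  fixes \<mu> :: "nat \<Rightarrow> (real ^ 'd::finite) measure"
  assumes \<mu>: "\<And>n. prob_space (\<mu> n)" "\<And>n. sets (\<mu> n) = sets borel"
    and \<nu>: "prob_space \<nu>" "sets \<nu> = sets borel"
    and conv: "\<And>u. (\<lambda>n. \<integral>x. iexp (u \<bullet> x) \<partial>\<mu> n) \<longlonglongrightarrow> (\<integral>x. iexp (u \<bullet> x) \<partial>\<nu>)"
    and f: "continuous_on UNIV f" and B: "\<And>x. \<bar>f x\<bar> \<le> B"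
  shows "(\<lambda>n. \<integral>x. f x \<partial>\<mu> n) \<longlonglongrightarrow> (\<integral>x. f x \<partial>\<nu> :: real)"
proof (rule LIMSEQ_I)
  fix r :: real assume "0 < r"
  have "0 \<le> B" using B[of undefined] by linarith
  \<comment> \<open>Replacing \<open>f\<close> by \<open>g\<close> will cost \<epsilon> +
    2B\<epsilon> under each of the two measures, and the convergence of the integrals of
    \<open>g\<close> costs another \<epsilon>; the total is (4B + 3)\<epsilon>.\<close>
  define \<epsilon> where "\<epsilon> = r / (4 * B + 3)"
  have "0 < \<epsilon>" and r: "r = (4 * B + 3) * \<epsilon>" using \<open>0 < r\<close> \<open>0 \<le> B\<close> by (auto simp: \<epsilon>_def)
  have [measurable_cong]: "sets (\<mu> n) = sets borel" "sets \<nu> = sets borel" for n by fact+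
  have [measurable]: "f \<in> borel_measurable borel"
    using f by (rule borel_measurable_continuous_onI)
  have nth[measurable]: "(\<lambda>x. x $ i) \<in> borel_measurable borel" for i :: 'd
    by (intro borel_measurable_continuous_onI continuous_intros)

  \<comment> \<open>A ramp that is 0 for \<bar>y\<bar> \<le> k and 1 for \<bar>y\<bar> \<ge> k + 1.
    It replaces an indicator because weak convergence tests continuous functions only.\<close>
  define h where "h k y = min 1 (max 0 (\<bar>y\<bar> - real k))" for k and y :: real
  have h_cont: "isCont (h k) y" for k y
    unfolding h_def by (intro continuous_intros)
  have [measurable]: "h k \<in> borel_measurable borel" for k
    by (intro borel_measurable_continuous_onI) (simp add: continuous_at_imp_continuous_on h_cont)
  have h_bounds: "0 \<le> h k y" "h k y \<le> 1" for k y by (auto simp: h_def)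
  define H where "H k x = (\<Sum>i\<in>UNIV. h k (x $ i))" for k and x :: "real^'d"
  have [measurable]: "H k \<in> borel_measurable borel" for k unfolding H_def by measurable
  have H_int: "integrable \<rho> (H k)" "integrable \<rho> (\<lambda>x. h k (x $ i))"
    if "prob_space \<rho>" "sets \<rho> = sets borel" for \<rho> k i
  proof -
    interpret prob_space \<rho> by fact
    have [measurable_cong]: "sets \<rho> = sets borel" by fact
    show *: "integrable \<rho> (\<lambda>x. h k (x $ i))" for i
      by (rule integrable_const_bound[of _ 1]) (auto simp: h_bounds)
    show "integrable \<rho> (H k)" unfolding H_def by (intro Bochner_Integration.integrable_sum *)
  qed
  have "(\<lambda>k. \<integral>x. H k x \<partial>\<nu>) \<longlonglongrightarrow> (\<integral>x. 0 \<partial>\<nu>)"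
  proof (rule integral_dominated_convergence[where w = "\<lambda>_. real CARD('d)"])
    interpret prob_space \<nu> by fact
    show "integrable \<nu> (\<lambda>_. real CARD('d))" by simp
    have "(\<lambda>k. H k x) \<longlonglongrightarrow> 0" for x
    proof (rule tendsto_eventually)
      have "H k x = 0" if "norm x \<le> real k" for k
        unfolding H_def h_def
      proof (intro sum.neutral ballI)
        fix i
        have "\<bar>x $ i\<bar> \<le> real k" using component_le_norm_cart[of x i] that by linarith
        then show "min 1 (max 0 (\<bar>x $ i\<bar> - real k)) = 0" by simp
      qed
      then show "\<forall>\<^sub>F k in sequentially. H k x = 0"
        by (intro eventually_sequentiallyI[of "nat \<lceil>norm x\<rceil>"]) (simp add: nat_ceiling_le_eq)
    qed
    then show "AE x in \<nu>. (\<lambda>k. H k x) \<longlonglongrightarrow> 0" by simp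
    have "\<bar>H k x\<bar> \<le> real CARD('d)" for k x
    proof -
      have "H k x \<le> of_nat (card (UNIV :: 'd set)) * 1"
        unfolding H_def by (rule sum_bounded_above) (rule h_bounds)
      moreover have "0 \<le> H k x" unfolding H_def by (intro sum_nonneg h_bounds)
      ultimately show ?thesis by simp
    qed
    then show "AE x in \<nu>. norm (H k x) \<le> real CARD('d)" for k by simp
  qed auto
  then have "\<forall>\<^sub>F k in sequentially. (\<integral>x. H k x \<partial>\<nu>) < \<epsilon>"
    using \<open>0 < \<epsilon>\<close> by (intro order_tendstoD) auto
  then obtain k where k: "(\<integral>x. H k x \<partial>\<nu>) < \<epsilon>" by (auto simp: eventually_sequentially)
  \<comment> \<open>This is where tightness comes from: the tails are controlled one coordinate at a
    time, and the characteristic function of coordinate \<open>i\<close> at \<open>t\<close> is the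
    joint one at \<open>axis i t\<close>.\<close>
  have "(\<lambda>n. \<integral>x. h k (x $ i) \<partial>\<mu> n) \<longlonglongrightarrow> (\<integral>x. h k (x $ i) \<partial>\<nu>)" for i
  proof -
    have rd: "real_distribution (distr \<rho> borel (\<lambda>x. x $ i))"
      if "prob_space \<rho>" "sets \<rho> = sets borel" for \<rho> :: "(real^'d) measure"
    proof -
      interpret prob_space \<rho> by fact
      show ?thesis by (rule real_distribution_distr) (simp add: measurable_cong_sets[OF that(2) refl] nth)
    qed
    have "weak_conv_m (\<lambda>n. distr (\<mu> n) borel (\<lambda>x. x $ i)) (distr \<nu> borel (\<lambda>x. x $ i))"
    proof (rule levy_continuity)
      fix t
      have eq: "char (distr \<rho> borel (\<lambda>x. x $ i)) t = (\<integral>x. iexp (axis i t \<bullet> x) \<partial>\<rho>)"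
        if "sets \<rho> = sets borel" for \<rho> :: "(real^'d) measure"
        unfolding char_def
        by (subst integral_distr) (auto simp: measurable_cong_sets[OF that refl] inner_axis')
      show "(\<lambda>n. char (distr (\<mu> n) borel (\<lambda>x. x $ i)) t) \<longlonglongrightarrow> char (distr \<nu> borel (\<lambda>x. x $ i)) t"
        using conv[of "axis i t"] by (simp add: eq \<mu> \<nu>)
    qed (intro rd \<mu> \<nu>)+
    then have "(\<lambda>n. integral\<^sup>L (distr (\<mu> n) borel (\<lambda>x. x $ i)) (h k))
        \<longlonglongrightarrow> integral\<^sup>L (distr \<nu> borel (\<lambda>x. x $ i)) (h k)"
      by (intro weak_conv_imp_integral_bdd_continuous_conv[where B = 1] rd \<mu> \<nu> h_cont)
         (auto simp: h_bounds)
    then show ?thesis by (simp add: integral_distr)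
  qed
  then have "(\<lambda>n. \<integral>x. H k x \<partial>\<mu> n) \<longlonglongrightarrow> (\<integral>x. H k x \<partial>\<nu>)"
    unfolding H_def by (simp add: H_int \<mu> \<nu> tendsto_sum)
  then have H_ev: "\<forall>\<^sub>F n in sequentially. (\<integral>x. H k x \<partial>\<mu> n) < \<epsilon>"
    using k by (rule order_tendstoD)

  \<comment> \<open>With this scaling \<bar>x $ i\<bar> \<le> k + 1 becomes \<bar>c * x $ i\<bar>
    \<le> pi / 2, the range on which \<open>arcsin\<close> inverts \<open>sin\<close>.\<close>
  define c where "c = pi / (2 * (real k + 1))"
  have "0 < c" by (simp add: c_def)
  define \<Phi> where "\<Phi> y = f (\<chi> i. arcsin (y $ i) / c)" for y :: "real^'d"
  define S :: "(real^'d) set" where "S = cbox (\<chi> i. - 1) (\<chi> i. 1)"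
  have S: "y \<in> S \<longleftrightarrow> (\<forall>i. \<bar>y $ i\<bar> \<le> 1)" for y
    by (auto simp: S_def mem_box_cart abs_le_iff minus_le_iff)
  have "continuous_on S \<Phi>"
    unfolding \<Phi>_def
  proof (rule continuous_on_compose2[OF f])
    show "continuous_on S (\<lambda>y. \<chi> i. arcsin (y $ i) / c)"
      using \<open>0 < c\<close> by (intro continuous_intros) (auto simp: S abs_le_iff minus_le_iff)
  qed simp
  \<comment> \<open>Vectors of sines lie in the compact cube \<open>S\<close> for every
    \<open>x\<close>, so this approximation on \<open>S\<close> yields a bound on the whole
    space.\<close>
  then obtain p where p: "real_polynomial_function p" "\<And>y. y \<in> S \<Longrightarrow> \<bar>\<Phi> y - p y\<bar> < \<epsilon>"
    using Stone_Weierstrass_real_polynomial_function[of S \<Phi> \<epsilon>] \<open>0 < \<epsilon>\<close> by (auto simp: S_def)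
  define g where "g x = p (\<chi> i. sin (c * x $ i))" for x
  have tg: "trig_poly (\<lambda>x. complex_of_real (g x))"
    unfolding g_def using p(1) by (rule trig_poly_of_polynomial)
  have fg: "\<bar>f x - g x\<bar> \<le> \<epsilon> + 2 * B * H k x" for x
  proof -
    have near: "\<bar>\<Phi> (\<chi> i. sin (c * x $ i)) - g x\<bar> < \<epsilon>"
      unfolding g_def by (intro p) (simp add: S)
    show ?thesis
    proof (cases "\<forall>i. \<bar>x $ i\<bar> \<le> real k + 1")
      case True
      have "arcsin (sin (c * x $ i)) / c = x $ i" for i
      proof -
        have "\<bar>c * x $ i\<bar> \<le> c * (real k + 1)"
          using True[rule_format, of i] \<open>0 < c\<close> by (simp add: abs_mult)
        also have "c * (real k + 1) = pi / 2" by (simp add: c_def add_pos_nonneg field_simps)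
        finally have "\<bar>c * x $ i\<bar> \<le> pi / 2" .
        then show ?thesis using \<open>0 < c\<close> by (subst arcsin_sin) (auto simp: abs_le_iff)
      qed
      then have "\<Phi> (\<chi> i. sin (c * x $ i)) = f x" by (simp add: \<Phi>_def)
      moreover have "0 \<le> B * H k x"
        using \<open>0 \<le> B\<close> by (intro mult_nonneg_nonneg) (auto simp: H_def intro!: sum_nonneg h_bounds)
      ultimately show ?thesis using near by linarith
    next
      case False
      \<comment> \<open>Outside the cube only the bound \<open>B\<close> on \<open>f\<close> and on
        its periodic extension is available. It gives 2B, which is affordable because
        \<open>H k x\<close> is at least 1 there.\<close>
      then obtain i where "\<bar>x $ i\<bar> > real k + 1" by (auto simp: not_le)
      then have "1 = h k (x $ i)" by (simp add: h_def)
      also have "\<dots> \<le> H k x" unfolding H_def by (intro member_le_sum) (auto simp: h_bounds)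
      finally have "2 * B \<le> 2 * B * H k x" using \<open>0 \<le> B\<close> mult_left_mono[of 1 "H k x" "2 * B"] by simp
      moreover have "\<bar>\<Phi> (\<chi> i. sin (c * x $ i))\<bar> \<le> B" unfolding \<Phi>_def by (rule B)
      ultimately show ?thesis using near B[of x] by linarith
    qed
  qed
  have int_fg: "\<bar>(\<integral>x. f x \<partial>\<rho>) - (\<integral>x. g x \<partial>\<rho>)\<bar> \<le> \<epsilon> + 2 * B * (\<integral>x. H k x \<partial>\<rho>)"
    if \<rho>: "prob_space \<rho>" "sets \<rho> = sets borel" for \<rho>
  proof -
    interpret prob_space \<rho> by fact
    have [measurable_cong]: "sets \<rho> = sets borel" by fact
    have i: "integrable \<rho> f" by (rule integrable_const_bound[of _ B]) (auto simp: B)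
    have g: "integrable \<rho> g"
      using trig_poly_integrable[OF tg \<rho>] by (simp only: complex_of_real_integrable_eq)
    have "\<bar>(\<integral>x. f x \<partial>\<rho>) - (\<integral>x. g x \<partial>\<rho>)\<bar> = \<bar>\<integral>x. f x - g x \<partial>\<rho>\<bar>" using i g by simp
    also have "\<dots> \<le> (\<integral>x. \<bar>f x - g x\<bar> \<partial>\<rho>)" by (rule integral_abs_bound)
    also have "\<dots> \<le> (\<integral>x. \<epsilon> + 2 * B * H k x \<partial>\<rho>)"
      using i g fg by (intro integral_mono integrable_abs Bochner_Integration.integrable_diff) (auto simp: H_int \<rho>)
    also have "\<dots> = \<epsilon> + 2 * B * (\<integral>x. H k x \<partial>\<rho>)" by (simp add: H_int \<rho> prob_space)
    finally show ?thesis .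
  qed
  have "(\<lambda>n. \<integral>x. complex_of_real (g x) \<partial>\<mu> n) \<longlonglongrightarrow> (\<integral>x. complex_of_real (g x) \<partial>\<nu>)"
    by (rule trig_poly_integral_tendsto[OF tg \<mu> \<nu> conv])
  then have "(\<lambda>n. \<integral>x. g x \<partial>\<mu> n) \<longlonglongrightarrow> (\<integral>x. g x \<partial>\<nu>)"
    by (simp only: integral_complex_of_real tendsto_of_real_iff)
  then have "\<forall>\<^sub>F n in sequentially. \<bar>(\<integral>x. g x \<partial>\<mu> n) - (\<integral>x. g x \<partial>\<nu>)\<bar> < \<epsilon>"
    using \<open>0 < \<epsilon>\<close> by (auto simp: tendsto_iff dist_real_def)
  with H_ev have "\<forall>\<^sub>F n in sequentially. norm ((\<integral>x. f x \<partial>\<mu> n) - (\<integral>x. f x \<partial>\<nu>)) < r"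
  proof eventually_elim
    case (elim n)
    have "B * (\<integral>x. H k x \<partial>\<mu> n) \<le> B * \<epsilon>" "B * (\<integral>x. H k x \<partial>\<nu>) \<le> B * \<epsilon>"
      using \<open>0 \<le> B\<close> elim k by (auto intro!: mult_left_mono)
    moreover have "r = 4 * (B * \<epsilon>) + 3 * \<epsilon>" by (simp add: r algebra_simps)
    ultimately show ?case
      using int_fg[OF \<mu>, of n] int_fg[OF \<nu>] elim by (simp add: abs_if split: if_splits)
  qed
  then show "\<exists>no. \<forall>n\<ge>no. norm ((\<integral>x. f x \<partial>\<mu> n) - (\<integral>x. f x \<partial>\<nu>)) < r"
    by (simp add: eventually_sequentially)
qed

section \<open>Multivariate normal distributions\<close>

text \<open>The variances of all functionals give the quadratic form of \<Sigma>; polarization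
  together with symmetry then recovers each entry.\<close>

lemma gaussian_moments:
  fixes \<nu> :: "(real ^ 'd::finite) measure"
  assumes \<nu>: "prob_space \<nu>" "sets \<nu> = sets borel"
    and normal: "\<And>u. distr \<nu> borel (\<lambda>x. u \<bullet> x) = normal_real (u \<bullet> m) (sqrt (u \<bullet> (\<Sigma> *v u)))"
    and sym: "transpose \<Sigma> = \<Sigma>" and psd: "\<And>u. 0 \<le> u \<bullet> (\<Sigma> *v u)"
  shows "normal_law \<nu>" and "mean_vec \<nu> = m" and "cov_mat \<nu> = \<Sigma>"
proof -
  interpret prob_space \<nu> by fact
  have [measurable_cong]: "sets \<nu> = sets borel" by fact
  show "normal_law \<nu>"
    unfolding normal_law_def using \<nu> normal psd by (metis real_sqrt_ge_zero)
  have m1: "has_bochner_integral \<nu> (\<lambda>x. u \<bullet> x) (u \<bullet> m)" for u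
  proof -
    have "has_bochner_integral (distr \<nu> borel (\<lambda>x. u \<bullet> x)) (\<lambda>x. x) (u \<bullet> m)"
      unfolding normal by (rule normal_real_moments) (simp add: psd)
    then show ?thesis by (simp add: has_bochner_integral_iff integrable_distr_eq integral_distr)
  qed
  have m2: "has_bochner_integral \<nu> (\<lambda>x. (u \<bullet> (x - m))\<^sup>2) (u \<bullet> (\<Sigma> *v u))" for u
  proof -
    have "has_bochner_integral (distr \<nu> borel (\<lambda>x. u \<bullet> x)) (\<lambda>x. (x - u \<bullet> m)\<^sup>2) ((sqrt (u \<bullet> (\<Sigma> *v u)))\<^sup>2)"
      unfolding normal by (rule normal_real_moments) (simp add: psd)
    then show ?thesis
      by (simp add: psd inner_diff_right has_bochner_integral_iff integrable_distr_eq integral_distr)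
  qed
  have "has_bochner_integral \<nu> (\<lambda>x. \<Sum>i\<in>UNIV. (axis i 1 \<bullet> x) *\<^sub>R axis i (1::real)) (\<Sum>i\<in>UNIV. (axis i 1 \<bullet> m) *\<^sub>R axis i 1)"
    by (intro has_bochner_integral_sum has_bochner_integral_scaleR_left m1)
  then have "has_bochner_integral \<nu> (\<lambda>x. x) m"
    using basis_expansion[where 'a = real and 'n = 'd] by (simp add: inner_axis' scalar_mult_eq_scaleR)
  then show mean: "mean_vec \<nu> = m"
    by (simp add: mean_vec_def has_bochner_integral_iff)
  have "(\<integral>x. (x $ i - m $ i) * (x $ j - m $ j) \<partial>\<nu>) = \<Sigma> $ i $ j" for i j
  proof -
    define q where "q u x = (u \<bullet> (x - m))\<^sup>2" for u x
    have q: "integrable \<nu> (q u)" "integral\<^sup>L \<nu> (q u) = u \<bullet> (\<Sigma> *v u)" for u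
      using m2[of u] by (simp_all add: has_bochner_integral_iff q_def[abs_def])
    have "(\<integral>x. (x $ i - m $ i) * (x $ j - m $ j) \<partial>\<nu>)
        = (\<integral>x. (q (axis i 1 + axis j 1) x - q (axis i 1) x - q (axis j 1) x) / 2 \<partial>\<nu>)"
      by (intro Bochner_Integration.integral_cong)
         (auto simp: q_def inner_add_left inner_axis' power2_eq_square algebra_simps)
    also have "\<dots> = ((axis i 1 + axis j 1) \<bullet> (\<Sigma> *v (axis i 1 + axis j 1))
        - axis i 1 \<bullet> (\<Sigma> *v axis i 1) - axis j 1 \<bullet> (\<Sigma> *v axis j 1)) / 2"
      by (simp add: q)
    also have "\<dots> = (\<Sigma> $ i $ j + \<Sigma> $ j $ i) / 2"
      by (simp add: inner_add_left matrix_vector_right_distrib inner_axis' matrix_vector_mult_basis column_def)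
    also have "\<Sigma> $ j $ i = \<Sigma> $ i $ j"
      using sym by (metis transpose_def vec_lambda_beta)
    finally show ?thesis by simp
  qed
  then show "cov_mat \<nu> = \<Sigma>" by (simp add: cov_mat_def mean vec_eq_iff)
qed

text \<open>The law of \<open>m + S *v \<xi>\<close>, where \<xi> has independent standard normal
  coordinates. Prescribing a factor \<open>S\<close> instead of a covariance includes the degenerate
  cases.\<close>

lemma gaussian_exists:
  fixes m :: "real ^ 'd::finite" and S :: "real ^ 'k::finite ^ 'd"
  obtains \<nu> :: "(real ^ 'd) measure" where "prob_space \<nu>" and "sets \<nu> = sets borel"
    and "\<And>u. distr \<nu> borel (\<lambda>x. u \<bullet> x) = normal_real (u \<bullet> m) (norm (transpose S *v u))"
proof -
  interpret N: real_distribution "normal_real 0 1" by (rule real_distribution_normal_real) simp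
  interpret product_prob_space "\<lambda>_::'k. normal_real 0 1" UNIV by unfold_locales
  define M where "M = PiM (UNIV :: 'k set) (\<lambda>_. normal_real 0 1)"
  interpret M: prob_space M unfolding M_def by (rule prob_space_PiM) unfold_locales
  have sets_M[measurable_cong]: "sets M = sets (PiM UNIV (\<lambda>_. borel))"
    unfolding M_def by (rule sets_PiM_cong) simp_all
  have [measurable]: "(\<lambda>\<omega>. \<omega> i) \<in> borel_measurable M" for i by measurable
  have comp: "distr M borel (\<lambda>\<omega>. \<omega> i) = normal_real 0 1" for i
  proof -
    have "distr M borel (\<lambda>\<omega>. \<omega> i) = distr M (normal_real 0 1) (\<lambda>\<omega>. \<omega> i)"
      by (rule distr_cong) simp_all
    then show ?thesis using PiM_component[of i] by (simp add: M_def)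
  qed
  \<comment> \<open>Independence of the coordinates means that their joint law is the product of the
    marginals; here the joint map is the identity on the product space.\<close>
  have "M.indep_vars (\<lambda>_. borel) (\<lambda>i \<omega>. \<omega> i) UNIV"
  proof (subst M.indep_vars_iff_distr_eq_PiM)
    have "distr M (PiM UNIV (\<lambda>_. borel)) (\<lambda>\<omega>. \<lambda>i\<in>UNIV. \<omega> i) = distr M M (\<lambda>\<omega>. \<omega>)"
      by (rule distr_cong) (simp_all add: sets_M restrict_UNIV)
    then show "distr M (PiM UNIV (\<lambda>_. borel)) (\<lambda>\<omega>. \<lambda>i\<in>UNIV. \<omega> i) = PiM UNIV (\<lambda>i. distr M borel (\<lambda>\<omega>. \<omega> i))"
      by (simp add: comp distr_id2 M_def[symmetric])
  qed auto
  then have indep: "M.indep_vars (\<lambda>_. borel) (\<lambda>i \<omega>. c i * \<omega> i) UNIV" for c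
    by (rule M.indep_vars_compose2) simp
  define Y where "Y \<omega> = m + S *v (\<chi> i. \<omega> i)" for \<omega>
  have [measurable]: "(\<lambda>\<omega>. \<chi> i. \<omega> i) \<in> borel_measurable M"
    by (subst borel_measurable_euclidean_space) (auto simp: Basis_vec_def inner_axis)
  have [measurable]: "(\<lambda>x. S *v x) \<in> borel_measurable borel"
    by (intro borel_measurable_continuous_onI linear_continuous_on) simp
  have [measurable]: "Y \<in> borel_measurable M" unfolding Y_def by measurable
  show thesis
  proof
    show "prob_space (distr M borel Y)" by (rule M.prob_space_distr) simp
    show "sets (distr M borel Y) = sets borel" by simp
    fix u
    define c where "c = transpose S *v u"
    have "u \<bullet> Y \<omega> = u \<bullet> m + (\<Sum>i\<in>UNIV. c $ i * \<omega> i)" for \<omega>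
    proof -
      have "u \<bullet> Y \<omega> = u \<bullet> m + c \<bullet> (\<chi> i. \<omega> i)"
        unfolding Y_def c_def by (simp add: inner_add_right dot_lmul_matrix transpose_matrix_vector)
      then show ?thesis by (simp add: inner_vec_def)
    qed
    moreover have "distr M borel (\<lambda>\<omega>. \<Sum>i\<in>UNIV. c $ i * \<omega> i) = normal_real (\<Sum>i\<in>UNIV. c $ i * 0) (sqrt (\<Sum>i\<in>UNIV. (\<bar>c $ i\<bar> * 1)\<^sup>2))"
      by (intro M.distr_sum_normal_real indep M.distr_mult_normal_real) (auto simp: comp)
    then have "distr M borel (\<lambda>\<omega>. \<Sum>i\<in>UNIV. c $ i * \<omega> i) = normal_real 0 (norm c)"
      by (simp add: norm_vec_def L2_set_def)
    then have "distr M borel (\<lambda>\<omega>. u \<bullet> m + (\<Sum>i\<in>UNIV. c $ i * \<omega> i)) = normal_real (u \<bullet> m + 0) (norm c)"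
      by (intro M.distr_add_normal_real) auto
    ultimately show "distr (distr M borel Y) borel (\<lambda>x. u \<bullet> x) = normal_real (u \<bullet> m) (norm (transpose S *v u))"
      by (simp add: distr_distr comp_def c_def)
  qed
qed

section \<open>Linear equations and Riemann sums\<close>

lemma has_vector_derivative_vec:
  fixes f :: "real \<Rightarrow> real ^ 'd::finite"
  assumes "\<And>i. ((\<lambda>t. f t $ i) has_real_derivative f' $ i) F"
  shows "(f has_vector_derivative f') F"
proof -
  have comp: "((\<lambda>t. f t $ i) has_derivative (\<lambda>x. x * f' $ i)) F" for i
    using assms[of i] by (simp add: has_field_derivative_def mult_commute_abs)
  have "((\<lambda>t. \<Sum>i\<in>UNIV. f t $ i *\<^sub>R axis i (1::real)) has_derivative (\<lambda>x. \<Sum>i\<in>UNIV. (x * f' $ i) *\<^sub>R axis i 1)) F"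
    by (intro has_derivative_sum has_derivative_scaleR_left comp)
  also have "(\<lambda>x. \<Sum>i\<in>UNIV. (x * f' $ i) *\<^sub>R axis i 1) = (\<lambda>x. x *\<^sub>R (\<Sum>i\<in>UNIV. f' $ i *\<^sub>R axis i 1))"
    by (simp add: scaleR_sum_right)
  finally have "((\<lambda>t. \<Sum>i\<in>UNIV. f t $ i *\<^sub>R axis i (1::real)) has_vector_derivative (\<Sum>i\<in>UNIV. f' $ i *\<^sub>R axis i 1)) F"
    by (simp only: has_vector_derivative_def)
  then show ?thesis
    using basis_expansion[where 'a = real and 'n = 'd] by (simp add: scalar_mult_eq_scaleR)
qed

text \<open>The solution is exp(tC)u, written as one scalar power series per coordinate. The bound
  by the exponential series of the operator norm gives convergence everywhere, hence termwise
  differentiation.\<close>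

lemma linear_ode_solution_exists:
  fixes C :: "real ^ 'd::finite ^ 'd" and u :: "real ^ 'd"
  obtains \<eta> where "\<eta> 0 = u" and "\<And>t. (\<eta> has_vector_derivative (C *v \<eta> t)) (at t)"
proof -
  define v where "v n = ((*v) C ^^ n) u" for n
  define K where "K = onorm ((*v) C)"
  have v_bound: "norm (v n) \<le> norm u * K ^ n" for n
  proof (induction n)
    case (Suc n)
    have "norm (v (Suc n)) \<le> K * norm (v n)"
      unfolding v_def K_def by (simp add: onorm matrix_vector_mul_bounded_linear)
    also have "\<dots> \<le> K * (norm u * K ^ n)"
      using Suc by (intro mult_left_mono) (auto simp: K_def onorm_pos_le)
    finally show ?case by (simp add: mult_ac)
  qed (simp add: v_def)
  define c where "c i n = v n $ i / fact n" for i n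
  have summable: "summable (\<lambda>n. c i n * y ^ n)" for i y
  proof (rule summable_comparison_test')
    show "summable (\<lambda>n. norm u * (inverse (fact n) * (K * \<bar>y\<bar>) ^ n))"
      by (intro summable_mult summable_exp)
    show "norm (c i n * y ^ n) \<le> norm u * (inverse (fact n) * (K * \<bar>y\<bar>) ^ n)" for n
    proof -
      have "\<bar>v n $ i\<bar> * (\<bar>y\<bar> ^ n / fact n) \<le> (norm u * K ^ n) * (\<bar>y\<bar> ^ n / fact n)"
        using component_le_norm_cart[of "v n" i] v_bound[of n] by (intro mult_right_mono) auto
      then show ?thesis by (simp add: c_def abs_mult power_abs power_mult_distrib field_simps)
    qed
  qed
  define \<eta> where "\<eta> t = (\<chi> i. \<Sum>n. c i n * t ^ n)" for t
  show thesis
  proof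
    have "\<eta> 0 $ i = u $ i" for i
      using powser_zero[of "c i"] by (simp add: \<eta>_def c_def v_def)
    then show "\<eta> 0 = u" by (simp add: vec_eq_iff)
    fix t
    show "(\<eta> has_vector_derivative (C *v \<eta> t)) (at t)"
    proof (rule has_vector_derivative_vec)
      fix i
      have "diffs (c i) n = (\<Sum>j\<in>UNIV. C $ i $ j * c j n)" for n
        by (simp add: diffs_def c_def v_def matrix_vector_mult_def sum_divide_distrib sum_distrib_left del: of_nat_Suc)
      then have "(\<Sum>n. diffs (c i) n * t ^ n) = (\<Sum>n. \<Sum>j\<in>UNIV. C $ i $ j * (c j n * t ^ n))"
        by (simp add: sum_distrib_left mult_ac)
      also have "\<dots> = (\<Sum>j\<in>UNIV. \<Sum>n. C $ i $ j * (c j n * t ^ n))"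
        by (intro suminf_sum summable_mult summable)
      also have "\<dots> = (C *v \<eta> t) $ i"
        by (simp add: suminf_mult summable \<eta>_def matrix_vector_mult_def)
      finally show "((\<lambda>t. \<eta> t $ i) has_real_derivative (C *v \<eta> t) $ i) (at t)"
        using termdiffs_strong_converges_everywhere[OF summable, of i t] by (simp add: \<eta>_def)
    qed
  qed
qed

text \<open>Local errors \<epsilon>(b - a) add up to \<epsilon>T. The two-point functional
  \<open>q\<close> is kept abstract, so that the same argument serves for Riemann sums and, path by
  path, for the stochastic sums. The partition has \<open>Suc n\<close> cells, which avoids division
  by zero.\<close>

lemma telescoping_sum_tendsto:
  fixes r :: "real \<Rightarrow> real"
  assumes "0 \<le> T"
    and approx: "\<And>\<epsilon>. 0 < \<epsilon> \<Longrightarrow> \<exists>\<delta>>0. \<forall>a b. 0 \<le> a \<longrightarrow> a \<le> b \<longrightarrow> b \<le> T \<longrightarrow> b - a < \<delta> \<longrightarrow>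
        \<bar>r b - r a - q a b\<bar> \<le> \<epsilon> * (b - a)"
  shows "(\<lambda>n. \<Sum>k<Suc n. q (T * real k / Suc n) (T * real (Suc k) / Suc n)) \<longlonglongrightarrow> r T - r 0"
proof (rule LIMSEQ_I)
  fix e :: real assume "0 < e"
  \<comment> \<open>Dividing by T + 1 instead of T allows T = 0 and makes \<epsilon>T < e
    strict.\<close>
  define \<epsilon> where "\<epsilon> = e / (T + 1)"
  have "0 < \<epsilon>" "\<epsilon> * T < e" using \<open>0 < e\<close> \<open>0 \<le> T\<close> by (auto simp: \<epsilon>_def field_simps)
  then obtain \<delta> where \<delta>: "0 < \<delta>"
    "\<And>a b. 0 \<le> a \<Longrightarrow> a \<le> b \<Longrightarrow> b \<le> T \<Longrightarrow> b - a < \<delta> \<Longrightarrow> \<bar>r b - r a - q a b\<bar> \<le> \<epsilon> * (b - a)"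
    using approx by metis
  have "(\<lambda>n. T * (1 / real (Suc n))) \<longlonglongrightarrow> T * 0"
    using LIMSEQ_inverse_real_of_nat by (intro tendsto_intros) (simp add: inverse_eq_divide)
  then have "\<forall>\<^sub>F n in sequentially. T * (1 / real (Suc n)) < \<delta>"
    using \<delta>(1) by (intro order_tendstoD) auto
  then obtain n0 where n0: "\<And>n. n \<ge> n0 \<Longrightarrow> T / real (Suc n) < \<delta>"
    by (auto simp: eventually_sequentially)
  have "norm ((\<Sum>k<Suc n. q (T * real k / Suc n) (T * real (Suc k) / Suc n)) - (r T - r 0)) < e" if "n \<ge> n0" for n
  proof -
    define t where "t k = T * real k / Suc n" for k
    have t_mono: "t k \<le> t l" if "k \<le> l" for k l
      using that \<open>0 \<le> T\<close> by (simp add: t_def divide_right_mono mult_left_mono)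
    have t_ends: "t 0 = 0" "t (Suc n) = T"
      unfolding t_def by (simp, subst nonzero_mult_div_cancel_right) simp_all
    have step: "\<bar>r (t (Suc k)) - r (t k) - q (t k) (t (Suc k))\<bar> \<le> \<epsilon> * (t (Suc k) - t k)" if "k < Suc n" for k
    proof (rule \<delta>(2))
      show "0 \<le> t k" using t_mono[of 0 k] t_ends by simp
      show "t k \<le> t (Suc k)" by (rule t_mono) simp
      show "t (Suc k) \<le> T" using t_mono[of "Suc k" "Suc n"] that t_ends by simp
      have "t (Suc k) - t k = T / Suc n" unfolding t_def diff_divide_distrib[symmetric] right_diff_distrib[symmetric] by simp
      then show "t (Suc k) - t k < \<delta>" using n0[OF \<open>n \<ge> n0\<close>] by simp
    qed
    have "r T - r 0 = (\<Sum>k<Suc n. r (t (Suc k)) - r (t k))"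
      using sum_lessThan_telescope[of "\<lambda>k. r (t k)" "Suc n"] by (simp only: t_ends)
    then have "\<bar>(r T - r 0) - (\<Sum>k<Suc n. q (t k) (t (Suc k)))\<bar>
        = \<bar>\<Sum>k<Suc n. r (t (Suc k)) - r (t k) - q (t k) (t (Suc k))\<bar>"
      by (simp only: sum_subtractf)
    also have "\<dots> \<le> (\<Sum>k<Suc n. \<bar>r (t (Suc k)) - r (t k) - q (t k) (t (Suc k))\<bar>)" by (rule sum_abs)
    also have "\<dots> \<le> (\<Sum>k<Suc n. \<epsilon> * (t (Suc k) - t k))" by (intro sum_mono step) simp
    also have "\<dots> = \<epsilon> * T"
      unfolding sum_distrib_left[symmetric] sum_lessThan_telescope by (simp add: t_ends)
    finally show ?thesis using \<open>\<epsilon> * T < e\<close> by (simp only: t_def real_norm_def abs_minus_commute)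
  qed
  then show "\<exists>n0. \<forall>n\<ge>n0. norm ((\<Sum>k<Suc n. q (T * real k / Suc n) (T * real (Suc k) / Suc n)) - (r T - r 0)) < e"
    by blast
qed

text \<open>Uniform continuity of \<open>f\<close> makes the left-endpoint linearization of its
  primitive \<open>F\<close> accurate to \<epsilon>(b - a), as the telescoping argument
  requires.\<close>

lemma riemann_sum_tendsto:
  fixes F :: "real \<Rightarrow> real"
  assumes "0 \<le> T" and F: "\<And>t. (F has_real_derivative f t) (at t)" and f: "continuous_on {0..T} f"
  shows "(\<lambda>n. \<Sum>k<Suc n. f (T * real k / Suc n) * (T * real (Suc k) / Suc n - T * real k / Suc n)) \<longlonglongrightarrow> F T - F 0"
proof (rule telescoping_sum_tendsto[OF \<open>0 \<le> T\<close>, where q = "\<lambda>a b. f a * (b - a)"])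
  fix \<epsilon> :: real assume "0 < \<epsilon>"
  have "uniformly_continuous_on {0..T} f" using f by (rule compact_uniformly_continuous) simp
  then obtain \<delta> where \<delta>: "0 < \<delta>" "\<And>s t. s \<in> {0..T} \<Longrightarrow> t \<in> {0..T} \<Longrightarrow> dist s t < \<delta> \<Longrightarrow> dist (f s) (f t) < \<epsilon>"
    using \<open>0 < \<epsilon>\<close> unfolding uniformly_continuous_on_def by metis
  have "\<bar>F b - F a - f a * (b - a)\<bar> \<le> \<epsilon> * (b - a)" if "0 \<le> a" "a \<le> b" "b \<le> T" "b - a < \<delta>" for a b
  proof -
    have "norm (F b - F a - (b - a) *\<^sub>R f a) \<le> norm (b - a) * \<epsilon>"
    proof (rule vector_differentiable_bound_linearization[where S = "{a..b}" and f' = f and ?x0.0 = a])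
      show "(F has_vector_derivative f x) (at x within {a..b})" for x
        using F[of x] by (simp add: has_real_derivative_iff_has_vector_derivative has_vector_derivative_at_within)
      show "norm (f x - f a) \<le> \<epsilon>" if "x \<in> {a..b}" for x
        using \<delta>(2)[of x a] that \<open>0 \<le> a\<close> \<open>b \<le> T\<close> \<open>b - a < \<delta>\<close> by (auto simp: dist_norm)
    qed (use that in \<open>auto simp: closed_segment_eq_real_ivl\<close>)
    then show ?thesis using that by (simp add: mult.commute)
  qed
  then show "\<exists>\<delta>>0. \<forall>a b. 0 \<le> a \<longrightarrow> a \<le> b \<longrightarrow> b \<le> T \<longrightarrow> b - a < \<delta> \<longrightarrow>
      \<bar>F b - F a - f a * (b - a)\<bar> \<le> \<epsilon> * (b - a)"
    using \<delta>(1) by blast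
qed

text \<open>
  Removing the noise makes \<open>x - G w\<close> differentiable, and \<open>y \<bullet> (x - G w) + y \<bullet> G w b\<close> has the
  derivative \<open>y' \<bullet> G (w b - w s)\<close> because \<open>y\<close> solves the adjoint equation.
\<close>

lemma adjoint_increment:
  fixes B :: "real ^ 'd::finite ^ 'd" and G :: "real ^ 'n::finite ^ 'd"
  assumes x: "continuous_on {0..} x" "\<And>t. 0 \<le> t \<Longrightarrow> x t = z + integral {0..t} (\<lambda>s. B *v x s) + G *v w t"
    and y: "\<And>s. (y has_vector_derivative - (transpose B *v y s)) (at s)"
    and ab: "0 \<le> a" "a \<le> b"
    and C: "\<And>s. s \<in> {a..b} \<Longrightarrow> norm (transpose G *v (transpose B *v y s)) \<le> C"
    and e: "\<And>s. s \<in> {a..b} \<Longrightarrow> norm (w b - w s) \<le> e"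
  shows "\<bar>y b \<bullet> x b - y a \<bullet> x a - (transpose G *v y a) \<bullet> (w b - w a)\<bar> \<le> C * e * (b - a)"
proof -
  \<comment> \<open>The correction \<open>G *v w b - G *v w s\<close> vanishes at \<open>b\<close>
    and equals \<open>G *v (w b - w a)\<close> at \<open>a\<close>, so \<open>F b - F a\<close> is
    exactly the expression to be bounded.\<close>
  define F where "F s = y s \<bullet> (x s - G *v w s + G *v w b)" for s
  have "(F has_real_derivative (transpose G *v (transpose B *v y s)) \<bullet> (w s - w b)) (at s within {a..b})"
    if s: "s \<in> {a..b}" for s
  proof -
    have "((\<lambda>t. z + integral {0..t} (\<lambda>s. B *v x s)) has_vector_derivative B *v x s) (at s within {0..b})"
      using s ab x(1)
      by (auto intro!: derivative_eq_intros integral_has_vector_derivative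
          bounded_linear.continuous_on[OF matrix_vector_mul_bounded_linear] elim: continuous_on_subset)
    then have x': "((\<lambda>t. x t - G *v w t) has_vector_derivative B *v x s) (at s within {a..b})"
      using s ab by (rule_tac has_vector_derivative_weaken) (auto simp: x(2))
    have "(F has_vector_derivative
        y s \<bullet> (B *v x s) + - (transpose B *v y s) \<bullet> (x s - G *v w s + G *v w b)) (at s within {a..b})"
      unfolding F_def
    proof (rule bounded_bilinear.has_vector_derivative[OF bounded_bilinear_inner])
      show "(y has_vector_derivative - (transpose B *v y s)) (at s within {a..b})"
        by (rule has_vector_derivative_at_within[OF y])
      show "((\<lambda>s. x s - G *v w s + G *v w b) has_vector_derivative B *v x s) (at s within {a..b})"
        using has_vector_derivative_add[OF x' has_vector_derivative_const] by simp
    qed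
    also have "y s \<bullet> (B *v x s) + - (transpose B *v y s) \<bullet> (x s - G *v w s + G *v w b)
        = (transpose G *v (transpose B *v y s)) \<bullet> (w s - w b)"
      by (simp only: inner_minus_left inner_diff_right inner_add_right) (simp add: dot_lmul_matrix[symmetric])
    finally show ?thesis by (simp add: has_real_derivative_iff_has_vector_derivative)
  qed
  then have "norm (F b - F a) \<le> (C * e) * norm (b - a)"
  proof (rule field_differentiable_bound[where S = "{a..b}", rotated 1])
    fix s assume s: "s \<in> {a..b}"
    have "\<bar>(transpose G *v (transpose B *v y s)) \<bullet> (w s - w b)\<bar>
        \<le> norm (transpose G *v (transpose B *v y s)) * norm (w s - w b)"
      by (rule Cauchy_Schwarz_ineq2)
    also have "\<dots> \<le> C * e"
      using C[OF s] e[OF s] by (intro mult_mono) (auto simp: norm_minus_commute intro: order_trans[OF norm_ge_zero])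
    finally show "norm ((transpose G *v (transpose B *v y s)) \<bullet> (w s - w b)) \<le> C * e" by simp
  qed (use ab in auto)
  moreover have "F b - F a = y b \<bullet> x b - y a \<bullet> x a - (transpose G *v y a) \<bullet> (w b - w a)"
    by (simp add: F_def dot_lmul_matrix[symmetric] inner_diff_right inner_add_right)
  ultimately show ?thesis using ab by simp
qed

section \<open>Linear functionals of a linear SDE\<close>

text \<open>Independence is used twice: between the increments of one component, which makes each
  \<open>S j\<close> normal, and between the components, which lets the variances of the
  \<open>S j\<close> be added.\<close>

lemma brownian_increments_normal:
  fixes W :: "real \<Rightarrow> 'w \<Rightarrow> real ^ 'n::finite"
  assumes W: "brownian_motion P W" and \<tau>: "0 \<le> \<tau> 0" "\<And>i. i < k \<Longrightarrow> \<tau> i < \<tau> (Suc i)"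
  shows "distr P borel (\<lambda>\<omega>. \<Sum>i<k. c i \<bullet> (W (\<tau> (Suc i)) \<omega> - W (\<tau> i) \<omega>))
      = normal_real 0 (sqrt (\<Sum>i<k. (norm (c i))\<^sup>2 * (\<tau> (Suc i) - \<tau> i)))"
proof -
  have bm: "real_brownian_motion P (\<lambda>t \<omega>. W t \<omega> $ j)" for j
    using W by (simp add: brownian_motion_def)
  then interpret prob_space P by (simp add: real_brownian_motion_def)
  have \<tau>_nonneg: "0 \<le> \<tau> i" if "i \<le> k" for i
    using that by (induction i) (use \<tau> in \<open>auto simp: Suc_le_eq intro: order_trans less_imp_le\<close>)
  have [measurable]: "(\<lambda>\<omega>. W t \<omega> $ j) \<in> borel_measurable P" if "0 \<le> t" for t j
    using bm that by (auto simp: real_brownian_motion_def)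
  define S where "S j \<omega> = (\<Sum>i<k. c i $ j * (W (\<tau> (Suc i)) \<omega> $ j - W (\<tau> i) \<omega> $ j))" for j \<omega>
  define v where "v j = (\<Sum>i<k. (c i $ j)\<^sup>2 * (\<tau> (Suc i) - \<tau> i))" for j
  have v_nonneg: "0 \<le> v j" for j unfolding v_def using \<tau>(2) by (intro sum_nonneg mult_nonneg_nonneg) (auto simp: less_imp_le)
  have S_normal: "distr P borel (S j) = normal_real 0 (sqrt (v j))" for j
  proof -
    have "indep_vars (\<lambda>_. borel) (\<lambda>i \<omega>. W (\<tau> (Suc i)) \<omega> $ j - W (\<tau> i) \<omega> $ j) {..<k}"
      using bm[of j] \<tau> unfolding real_brownian_motion_def by blast
    then have "indep_vars (\<lambda>_. borel) (\<lambda>i \<omega>. c i $ j * (W (\<tau> (Suc i)) \<omega> $ j - W (\<tau> i) \<omega> $ j)) {..<k}"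
      by (rule indep_vars_compose2) simp
    then have "distr P borel (S j) = normal_real (\<Sum>i<k. c i $ j * 0) (sqrt (\<Sum>i<k. (\<bar>c i $ j\<bar> * sqrt (\<tau> (Suc i) - \<tau> i))\<^sup>2))"
      unfolding S_def
    proof (rule distr_sum_normal_real)
      fix i assume "i \<in> {..<k}"
      then have i: "0 \<le> \<tau> i" "\<tau> i < \<tau> (Suc i)" using \<tau>(2) \<tau>_nonneg by auto
      then show "distr P borel (\<lambda>\<omega>. c i $ j * (W (\<tau> (Suc i)) \<omega> $ j - W (\<tau> i) \<omega> $ j))
          = normal_real (c i $ j * 0) (\<bar>c i $ j\<bar> * sqrt (\<tau> (Suc i) - \<tau> i))"
        using bm[of j] by (intro distr_mult_normal_real) (auto simp: real_brownian_motion_def)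
    qed (use \<tau>(2) in \<open>auto simp: less_imp_le\<close>)
    moreover have "(\<Sum>i<k. (\<bar>c i $ j\<bar> * sqrt (\<tau> (Suc i) - \<tau> i))\<^sup>2) = v j"
      unfolding v_def using \<tau>(2) by (intro sum.cong) (auto simp: power_mult_distrib less_imp_le)
    ultimately show ?thesis by simp
  qed
  have "indep_vars (\<lambda>_. PiM {0..} (\<lambda>_. borel)) (\<lambda>j \<omega>. \<lambda>t\<in>{0..}. W t \<omega> $ j) UNIV"
    using W by (simp add: brownian_motion_def)
  \<comment> \<open>Independence of the components is given for whole paths on \<open>{0..}\<close>,
    so \<open>S j\<close> is first written as a measurable function of the restricted path; the
    times are nonnegative, hence the restriction has no effect.\<close>
  then have "indep_vars (\<lambda>_. borel) (\<lambda>j \<omega>. \<Sum>i<k. c i $ j * ((\<lambda>t\<in>{0..}. W t \<omega> $ j) (\<tau> (Suc i)) - (\<lambda>t\<in>{0..}. W t \<omega> $ j) (\<tau> i))) UNIV"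
  proof (rule indep_vars_compose2)
    fix j
    have "(\<lambda>x. x (\<tau> i)) \<in> borel_measurable (PiM {0..} (\<lambda>_. borel :: real measure))" if "i \<le> k" for i
      using \<tau>_nonneg[OF that] by (intro measurable_component_singleton) simp
    then show "(\<lambda>x. \<Sum>i<k. c i $ j * (x (\<tau> (Suc i)) - x (\<tau> i))) \<in> borel_measurable (PiM {0..} (\<lambda>_. borel))"
      by (intro borel_measurable_sum borel_measurable_times borel_measurable_diff) auto
  qed
  also have "(\<lambda>j \<omega>. \<Sum>i<k. c i $ j * ((\<lambda>t\<in>{0..}. W t \<omega> $ j) (\<tau> (Suc i)) - (\<lambda>t\<in>{0..}. W t \<omega> $ j) (\<tau> i))) = S"
    by (auto simp: fun_eq_iff S_def \<tau>_nonneg)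
  finally have "distr P borel (\<lambda>\<omega>. \<Sum>j\<in>UNIV. S j \<omega>) = normal_real (\<Sum>j::'n\<in>UNIV. 0) (sqrt (\<Sum>j\<in>UNIV. (sqrt (v j))\<^sup>2))"
    by (rule distr_sum_normal_real) (auto simp: S_normal v_nonneg)
  moreover have "(\<Sum>j\<in>UNIV. S j \<omega>) = (\<Sum>i<k. c i \<bullet> (W (\<tau> (Suc i)) \<omega> - W (\<tau> i) \<omega>))" for \<omega>
    unfolding S_def by (subst sum.swap) (simp add: inner_vec_def)
  moreover have "(\<Sum>j\<in>UNIV. (sqrt (v j))\<^sup>2) = (\<Sum>i<k. (norm (c i))\<^sup>2 * (\<tau> (Suc i) - \<tau> i))"
    unfolding real_sqrt_pow2[OF v_nonneg] unfolding v_def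
    by (subst sum.swap) (simp add: sum_distrib_right[symmetric] norm_vec_def L2_set_def sum_nonneg)
  ultimately show ?thesis by simp
qed

text \<open>The variance is the integral of the squared norm of
  \<open>transpose G *v \<eta> t\<close> over \<open>[0,T]\<close>. It is expressed through a
  primitive \<Theta> so that the Lyapunov equation can later supply it in closed form.\<close>

theorem linear_sde_functional_normal:
  fixes B :: "real ^ 'd::finite ^ 'd" and G :: "real ^ 'n::finite ^ 'd"
  assumes W: "brownian_motion P W" and X: "solves_linear_sde P B G W z X" and T: "0 < T"
    and \<eta>: "\<And>t. (\<eta> has_vector_derivative (transpose B *v \<eta> t)) (at t)"
    and \<Theta>: "\<And>t. (\<Theta> has_real_derivative (norm (transpose G *v \<eta> t))\<^sup>2) (at t)"
  shows "distr P borel (\<lambda>\<omega>. \<eta> 0 \<bullet> X T \<omega>) = normal_real (\<eta> T \<bullet> z) (sqrt (\<Theta> T - \<Theta> 0))"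
proof -
  have bm: "real_brownian_motion P (\<lambda>t \<omega>. W t \<omega> $ j)" for j
    using W by (simp add: brownian_motion_def)
  then interpret prob_space P by (simp add: real_brownian_motion_def)
  have [measurable]: "(\<lambda>\<omega>. W t \<omega> $ j) \<in> borel_measurable P" if "0 \<le> t" for t j
    using bm that by (auto simp: real_brownian_motion_def)
  have [measurable]: "X T \<in> borel_measurable P" using X T by (simp add: solves_linear_sde_def)
  \<comment> \<open>Reversing time turns the adjoint equation into y' = -B^T y, whose sign cancels
    the drift in y \<bullet> X. The endpoints are \<open>y 0 = \<eta> T\<close> and
    \<open>y T = \<eta> 0\<close>.\<close>
  define y where "y s = \<eta> (T - s)" for s
  have y: "(y has_vector_derivative - (transpose B *v y s)) (at s)" for s
  proof -
    have "((\<lambda>s. T - s) has_vector_derivative - 1) (at s)" by (auto intro!: derivative_eq_intros)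
    from vector_diff_chain_at[OF this \<eta>] show ?thesis by (simp add: y_def[abs_def] comp_def)
  qed
  have y_cont: "continuous_on S y" for S
    using y by (intro continuous_at_imp_continuous_on) (blast intro: has_vector_derivative_continuous)
  have cont: "continuous_on S (\<lambda>s. H *v f s)" if "continuous_on S f" for H :: "real^'p::finite^'q::finite" and f and S :: "real set"
    using that by (rule bounded_linear.continuous_on[OF matrix_vector_mul_bounded_linear])
  define g where "g s = transpose G *v y s" for s
  define t where "t n k = T * real k / real (Suc n)" for n k
  have t_mono: "t n k < t n (Suc k)" for n k using T by (simp add: t_def divide_strict_right_mono)
  have t_nonneg: "0 \<le> t n k" for n k using T by (simp add: t_def)
  \<comment> \<open>The integrand is deterministic, so each sum is a combination of independent
    increments with fixed coefficients. The constant \<open>\<eta> T \<bullet> z\<close> is the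
    contribution of the initial value.\<close>
  define S where "S n \<omega> = \<eta> T \<bullet> z + (\<Sum>k<Suc n. g (t n k) \<bullet> (W (t n (Suc k)) \<omega> - W (t n k) \<omega>))" for n \<omega>
  define v where "v n = (\<Sum>k<Suc n. (norm (g (t n k)))\<^sup>2 * (t n (Suc k) - t n k))" for n
  have v_nonneg: "0 \<le> v n" for n
    unfolding v_def using t_mono by (intro sum_nonneg mult_nonneg_nonneg) (auto simp: less_imp_le)
  have "v \<longlonglongrightarrow> - \<Theta> (T - T) - - \<Theta> (T - 0)"
    unfolding v_def t_def
  proof (rule riemann_sum_tendsto)
    show "((\<lambda>s. - \<Theta> (T - s)) has_real_derivative (norm (g s))\<^sup>2) (at s)" for s
    proof -
      have "((\<lambda>s. T - s) has_real_derivative - 1) (at s)" by (auto intro!: derivative_eq_intros)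
      from DERIV_minus[OF DERIV_chain'[OF this \<Theta>]] show ?thesis by (simp add: g_def y_def)
    qed
    show "continuous_on {0..T} (\<lambda>s. (norm (g s))\<^sup>2)"
      unfolding g_def by (intro continuous_intros cont y_cont)
  qed (use T in simp)
  then have v_lim: "v \<longlonglongrightarrow> \<Theta> T - \<Theta> 0" by simp
  have inc[measurable]: "(\<lambda>\<omega>. g (t n k) \<bullet> (W (t n (Suc k)) \<omega> - W (t n k) \<omega>)) \<in> borel_measurable P" for n k
    by (simp add: inner_vec_def t_nonneg)
  have S_normal: "distr P borel (S n) = normal_real (\<eta> T \<bullet> z) (sqrt (v n))" for n
  proof -
    have "distr P borel (S n) = normal_real (\<eta> T \<bullet> z + 0) (sqrt (v n))"
      unfolding S_def
    proof (rule distr_add_normal_real)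
      show "distr P borel (\<lambda>\<omega>. \<Sum>k<Suc n. g (t n k) \<bullet> (W (t n (Suc k)) \<omega> - W (t n k) \<omega>)) = normal_real 0 (sqrt (v n))"
        unfolding v_def by (rule brownian_increments_normal[where \<tau> = "t n", OF W t_nonneg t_mono])
      show "0 \<le> sqrt (v n)" by (simp add: v_nonneg)
    qed measurable
    then show ?thesis by simp
  qed
  obtain C where C: "\<And>s. s \<in> {0..T} \<Longrightarrow> norm (transpose G *v (transpose B *v y s)) \<le> C"
  proof -
    have "bounded ((\<lambda>s. transpose G *v (transpose B *v y s)) ` {0..T})"
      by (intro compact_imp_bounded compact_continuous_image cont y_cont) simp
    then show thesis using that unfolding bounded_iff by blast
  qed
  have "0 \<le> C" using C[of 0] T by (auto intro: order_trans[OF norm_ge_zero])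
  have lim: "(\<lambda>n. S n \<omega>) \<longlonglongrightarrow> \<eta> 0 \<bullet> X T \<omega>"
    if X: "continuous_on {0..} (\<lambda>t. X t \<omega>)" "\<And>t. 0 \<le> t \<Longrightarrow> X t \<omega> = z + integral {0..t} (\<lambda>s. B *v X s \<omega>) + G *v W t \<omega>"
      and w: "\<And>j. W 0 \<omega> $ j = 0" "\<And>j. continuous_on {0..} (\<lambda>t. W t \<omega> $ j)" for \<omega>
  proof -
    have W0: "W 0 \<omega> = 0" using w(1) by (simp add: vec_eq_iff)
    have "continuous_on {0..} (\<lambda>t. \<chi> j. W t \<omega> $ j)" by (intro continuous_on_vec_lambda w)
    then have "continuous_on {0..T} (\<lambda>t. W t \<omega>)" by (auto elim: continuous_on_subset)
    then have uc: "uniformly_continuous_on {0..T} (\<lambda>t. W t \<omega>)" by (rule compact_uniformly_continuous) simp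
    have "(\<lambda>n. \<Sum>k<Suc n. g (t n k) \<bullet> (W (t n (Suc k)) \<omega> - W (t n k) \<omega>)) \<longlonglongrightarrow> y T \<bullet> X T \<omega> - y 0 \<bullet> X 0 \<omega>"
      unfolding t_def
    proof (rule telescoping_sum_tendsto[where r = "\<lambda>s. y s \<bullet> X s \<omega>" and q = "\<lambda>a b. g a \<bullet> (W b \<omega> - W a \<omega>)"])
      fix \<epsilon> :: real assume "0 < \<epsilon>"
      \<comment> \<open>Adding 1 to C covers C = 0 while keeping C\<epsilon>' \<le>
        \<epsilon>.\<close>
      define \<epsilon>' where "\<epsilon>' = \<epsilon> / (C + 1)"
      have e: "0 < \<epsilon>'" "C * \<epsilon>' \<le> \<epsilon>" using \<open>0 \<le> C\<close> \<open>0 < \<epsilon>\<close> by (auto simp: \<epsilon>'_def field_simps)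
      obtain \<delta> where \<delta>: "0 < \<delta>" "\<And>s t. s \<in> {0..T} \<Longrightarrow> t \<in> {0..T} \<Longrightarrow> dist s t < \<delta> \<Longrightarrow> dist (W s \<omega>) (W t \<omega>) < \<epsilon>'"
        using uc e(1) unfolding uniformly_continuous_on_def by metis
      have "\<bar>y b \<bullet> X b \<omega> - y a \<bullet> X a \<omega> - g a \<bullet> (W b \<omega> - W a \<omega>)\<bar> \<le> \<epsilon> * (b - a)"
        if ab: "0 \<le> a" "a \<le> b" "b \<le> T" "b - a < \<delta>" for a b
      proof -
        have "\<bar>y b \<bullet> X b \<omega> - y a \<bullet> X a \<omega> - g a \<bullet> (W b \<omega> - W a \<omega>)\<bar> \<le> C * \<epsilon>' * (b - a)"
          unfolding g_def
        proof (rule adjoint_increment[OF X y ab(1,2)])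
          fix s assume s: "s \<in> {a..b}"
          show "norm (transpose G *v (transpose B *v y s)) \<le> C" using s ab by (intro C) auto
          show "norm (W b \<omega> - W s \<omega>) \<le> \<epsilon>'" using s ab \<delta>(2)[of b s] by (auto simp: dist_norm)
        qed
        also have "\<dots> \<le> \<epsilon> * (b - a)" using e ab by (intro mult_right_mono) auto
        finally show ?thesis .
      qed
      then show "\<exists>\<delta>>0. \<forall>a b. 0 \<le> a \<longrightarrow> a \<le> b \<longrightarrow> b \<le> T \<longrightarrow> b - a < \<delta> \<longrightarrow>
          \<bar>y b \<bullet> X b \<omega> - y a \<bullet> X a \<omega> - g a \<bullet> (W b \<omega> - W a \<omega>)\<bar> \<le> \<epsilon> * (b - a)"
        using \<delta>(1) by blast
    qed (use T in simp)
    then have "(\<lambda>n. S n \<omega>) \<longlonglongrightarrow> \<eta> T \<bullet> z + (y T \<bullet> X T \<omega> - y 0 \<bullet> X 0 \<omega>)"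
      unfolding S_def by (intro tendsto_intros)
    then show ?thesis using X(2)[of 0] by (simp add: W0 y_def)
  qed
  have "AE \<omega> in P. \<forall>j. W 0 \<omega> $ j = 0 \<and> continuous_on {0..} (\<lambda>t. W t \<omega> $ j)"
    using bm unfolding real_brownian_motion_def by (subst AE_all_countable) auto
  moreover have "AE \<omega> in P. continuous_on {0..} (\<lambda>t. X t \<omega>) \<and> (\<forall>t\<ge>0. X t \<omega> = z + integral {0..t} (\<lambda>s. B *v X s \<omega>) + G *v W t \<omega>)"
    using X by (simp add: solves_linear_sde_def)
  ultimately have AE_lim: "AE \<omega> in P. (\<lambda>n. S n \<omega>) \<longlonglongrightarrow> \<eta> 0 \<bullet> X T \<omega>"
    by eventually_elim (use lim in blast)
  show ?thesis
    by (rule distr_normal_real_AE_limit[OF _ _ AE_lim S_normal v_nonneg v_lim]) (auto simp: S_def[abs_def])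
qed

section \<open>The circulant matrix and its Green kernel\<close>

lemma cos_2pi_eq_1_iff:
  fixes x :: int
  assumes "0 < N"
  shows "cos (2 * pi * of_int x / real N) = 1 \<longleftrightarrow> int N dvd x"
proof
  assume "cos (2 * pi * of_int x / real N) = 1"
  then obtain k :: int where "2 * pi * of_int x / real N = of_int k * 2 * pi"
    by (auto simp: cos_one_2pi_int)
  then have "real_of_int x = of_int (int N * k)" using assms by (simp add: field_simps)
  then have "x = int N * k" by (simp only: of_int_eq_iff)
  then show "int N dvd x" by simp
next
  assume "int N dvd x"
  then obtain k where "x = int N * k" ..
  then show "cos (2 * pi * of_int x / real N) = 1"
    using assms cos_int_2pin[of k] by (simp add: mult_ac)
qed

text \<open>The real part of a geometric series whose ratio is an N-th root of unity different from
  1. The phase \<theta> accommodates the row offset when rows of \<open>K\<close> are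
  summed.\<close>

lemma sum_cos_roots_of_unity:
  fixes x :: int
  assumes "0 < N" and "\<not> int N dvd x"
  shows "(\<Sum>r<N. cos (\<theta> + 2 * pi * real r * of_int x / real N)) = 0"
proof -
  define \<phi> where "\<phi> = 2 * pi * of_int x / real N"
  have "cis \<phi> \<noteq> 1"
    using cos_2pi_eq_1_iff[of N x] assms by (auto simp: \<phi>_def complex_eq_iff)
  have "real N * \<phi> = 2 * pi * of_int x" using assms by (simp add: \<phi>_def)
  then have "cis \<phi> ^ N = cis (2 * pi * of_int x)" by (simp only: Complex.DeMoivre)
  then have "cis \<phi> ^ N = 1" using cis_multiple_2pi[of "of_int x"] by simp
  then have "(\<Sum>r<N. cis \<phi> ^ r) = 0"
    using \<open>cis \<phi> \<noteq> 1\<close> by (simp add: geometric_sum)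
  then have "(\<Sum>r<N. cis \<theta> * cis \<phi> ^ r) = 0" by (simp add: sum_distrib_left[symmetric])
  moreover have "cis \<theta> * cis \<phi> ^ r = cis (\<theta> + 2 * pi * real r * of_int x / real N)" for r
    unfolding Complex.DeMoivre cis_mult by (simp add: \<phi>_def mult_ac)
  ultimately have "(\<Sum>r<N. cis (\<theta> + 2 * pi * real r * of_int x / real N)) = 0" by simp
  from arg_cong[OF this, of Re] show ?thesis by simp
qed

locale ring_numbering =
  fixes \<iota> :: "'n::finite \<Rightarrow> nat"
  assumes bij: "bij_betw \<iota> UNIV {1..CARD('n)}" and card: "CARD('n) \<ge> 3"
begin

abbreviation A :: "real ^ 'n ^ 'n" where "A \<equiv> circ_A \<iota>"

section \<open>The cyclic shift and the action of \<open>A\<close>, its transpose and the centering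
  matrix\<close>

lemma \<iota>_range: "1 \<le> \<iota> m" "\<iota> m \<le> CARD('n)"
  using bij by (auto simp: bij_betw_def)

lemma \<iota>_eq_iff: "\<iota> m = \<iota> n \<longleftrightarrow> m = n"
  using bij by (auto simp: bij_betw_def inj_on_def)

text \<open>Labels start at 1, so the remainder is taken before 1 is added: the label N is sent to
  1.\<close>

definition nxt :: "'n \<Rightarrow> 'n" where "nxt m = inv_into UNIV \<iota> (\<iota> m mod CARD('n) + 1)"

definition prv :: "'n \<Rightarrow> 'n" where "prv = inv nxt"

lemma \<iota>_nxt: "\<iota> (nxt m) = \<iota> m mod CARD('n) + 1"
proof -
  have "\<iota> m mod CARD('n) + 1 \<in> {1..CARD('n)}" using card by (simp add: Suc_le_eq)
  then show ?thesis unfolding nxt_def using bij by (simp add: bij_betw_def f_inv_into_f)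
qed

lemma \<iota>_nxt_iff: "n = nxt m \<longleftrightarrow> \<iota> n = \<iota> m + 1 \<or> (\<iota> m = CARD('n) \<and> \<iota> n = 1)"
proof -
  have "n = nxt m \<longleftrightarrow> \<iota> n = \<iota> m mod CARD('n) + 1" by (metis \<iota>_nxt \<iota>_eq_iff)
  then show ?thesis
    using \<iota>_range[of m] \<iota>_range[of n] by (cases "\<iota> m = CARD('n)") auto
qed

lemma nxt_neq: "nxt m \<noteq> m"
  using \<iota>_nxt_iff[of m m] card by auto

lemma bij_nxt: "bij nxt"
proof -
  have "m = n" if "nxt m = nxt n" for m n
    using that \<iota>_nxt_iff[of "nxt m" m] \<iota>_nxt_iff[of "nxt m" n] \<iota>_range[of m] \<iota>_range[of n]
    by (auto simp: \<iota>_eq_iff[symmetric])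
  then have "inj nxt" by (auto intro: injI)
  then show ?thesis by (simp add: bij_def finite_UNIV_inj_surj)
qed

lemma nxt_prv [simp]: "nxt (prv m) = m" and prv_nxt [simp]: "prv (nxt m) = m"
  using bij_nxt by (simp_all add: prv_def bij_is_surj surj_f_inv_f bij_is_inj inv_f_f)

text \<open>\<open>A\<close> is the cyclic shift minus the identity, a difference operator. From
  here on it is handled through \<open>nxt\<close> and \<open>prv\<close> alone.\<close>

lemma circ_A_nth: "A $ m $ n = (if n = nxt m then 1 else 0) - (if n = m then 1 else 0)"
  using nxt_neq[of m] card by (auto simp: circ_A_def \<iota>_nxt_iff)

lemma A_mult_nth: "(A *v v) $ m = v $ nxt m - v $ m"
  by (simp add: matrix_vector_mult_def circ_A_nth left_diff_distrib sum_subtractf if_distrib[of "\<lambda>x. x * _"] cong: if_cong)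

lemma At_mult_nth: "(transpose A *v v) $ m = v $ prv m - v $ m"
proof -
  have "m = nxt n \<longleftrightarrow> n = prv m" for n by auto
  then show ?thesis
    by (simp add: matrix_vector_mult_def transpose_def circ_A_nth left_diff_distrib sum_subtractf if_distrib[of "\<lambda>x. x * _"] cong: if_cong)
qed

lemma sum_nxt: "(\<Sum>m\<in>UNIV. f (nxt m)) = (\<Sum>m\<in>UNIV. f m)"
  using bij_nxt by (rule sum.reindex_bij_betw)

lemma sum_prv: "(\<Sum>m\<in>UNIV. f (prv m)) = (\<Sum>m\<in>UNIV. f m)"
  using sum_nxt[of "\<lambda>m. f (prv m)"] by simp

lemma sum_A: "(\<Sum>m\<in>UNIV. (A *v v) $ m) = 0"
  using sum_nxt[of "\<lambda>m. v $ m"] by (simp add: A_mult_nth sum_subtractf)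

lemma sum_At: "(\<Sum>m\<in>UNIV. (transpose A *v v) $ m) = 0"
  using sum_prv[of "\<lambda>m. v $ m"] by (simp add: At_mult_nth sum_subtractf del: transpose_matrix_vector)

text \<open>The cyclic shift is orthogonal, so it commutes with its transpose, and so does its
  difference with the identity.\<close>

lemma A_normal: "A *v (transpose A *v v) = transpose A *v (A *v v)"
  by (simp add: vec_eq_iff A_mult_nth At_mult_nth del: transpose_matrix_vector)

lemma M_mult_nth: "(centering_M *v v :: real^'n) $ m = v $ m - (\<Sum>k\<in>UNIV. v $ k) / CARD('n)"
  by (simp add: centering_M_def matrix_vector_mult_diff_rdistrib scaleR_matrix_vector_assoc[symmetric])
     (simp add: matrix_vector_mult_def sum_divide_distrib)

lemma A_M: "A *v (centering_M *v v) = A *v v"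
  by (simp add: vec_eq_iff A_mult_nth M_mult_nth)

lemma M_At: "centering_M *v (transpose A *v v) = transpose A *v v"
  by (simp add: vec_eq_iff M_mult_nth sum_At del: transpose_matrix_vector)

text \<open>The entry of \<open>mat_K\<close> at label difference \<open>x\<close>, with the
  exponentials already reduced to cosines. A real argument lets shifts by 1 and periodicity be used
  without modular arithmetic on indices.\<close>

definition kernel :: "real \<Rightarrow> real" where
  "kernel x = (\<Sum>j = 1..CARD('n) - 1. cos (2 * pi * real j * x / CARD('n)) / eig_mu CARD('n) j) / CARD('n)"

definition K :: "real ^ 'n ^ 'n" where
  "K = (\<chi> m n. kernel (real (\<iota> m) - real (\<iota> n)))"

section \<open>Symmetries of the kernel and the identities for \<open>K\<close>\<close>

lemma eig_mu_nonzero: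
  assumes "1 \<le> j" "j \<le> CARD('n) - 1"
  shows "eig_mu CARD('n) j \<noteq> 0"
proof -
  have "\<not> int CARD('n) dvd int j" using assms card by (auto dest: dvd_imp_le)
  then show ?thesis using cos_2pi_eq_1_iff[of "CARD('n)" "int j"] by (simp add: eig_mu_def)
qed

lemma eig_mu_sym: "j \<le> CARD('n) \<Longrightarrow> eig_mu CARD('n) (CARD('n) - j) = eig_mu CARD('n) j"
  using card by (simp add: eig_mu_def of_nat_diff right_diff_distrib diff_divide_distrib cos_diff)

lemma kernel_minus: "kernel (- x) = kernel x"
  by (simp add: kernel_def)

lemma kernel_periodic: "kernel ((x :: real) + CARD('n)) = kernel x"
proof -
  have "cos (2 * pi * real j * (x + CARD('n)) / CARD('n)) = cos (2 * pi * real j * x / CARD('n))" for j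
  proof -
    have "2 * pi * real j * (x + CARD('n)) / CARD('n) = 2 * pi * real j * x / CARD('n) + 2 * pi * real j"
      using card by (simp add: field_simps)
    then show ?thesis using sin_npi[of "2 * j"] cos_npi[of "2 * j"] by (simp add: cos_add mult_ac)
  qed
  then show ?thesis by (simp only: kernel_def)
qed

text \<open>Periodicity absorbs the wrap-around from label N to label 1, so the cyclic shift acts as
  an honest translation.\<close>

lemma kernel_nxt: "kernel (real (\<iota> (nxt m)) + y) = kernel (real (\<iota> m) + y + 1)"
proof (cases "\<iota> m = CARD('n)")
  case True
  then show ?thesis using kernel_periodic[of "1 + y"] by (simp add: \<iota>_nxt add_ac)
next
  case False
  then have "\<iota> m mod CARD('n) = \<iota> m" using \<iota>_range[of m] by simp
  then show ?thesis by (simp add: \<iota>_nxt add_ac)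
qed

lemma kernel_prv: "kernel (real (\<iota> (prv m)) + y) = kernel (real (\<iota> m) + y - 1)"
  using kernel_nxt[of "prv m" "y - 1"] by (simp add: algebra_simps)

lemma kernel_prv_minus: "kernel (y - real (\<iota> (prv m))) = kernel (y - real (\<iota> m) + 1)"
  using kernel_prv[of m "- y"] kernel_minus[of "y - real (\<iota> (prv m))"] kernel_minus[of "y - real (\<iota> m) + 1"]
  by simp

lemma K_sym: "transpose K = K"
proof -
  have "kernel (real (\<iota> n) - real (\<iota> m)) = kernel (real (\<iota> m) - real (\<iota> n))" for m n
    using kernel_minus[of "real (\<iota> m) - real (\<iota> n)"] by simp
  then show ?thesis by (simp add: K_def transpose_def vec_eq_iff)
qed

lemma matrix_mult_column: "(X ** Y) $ m $ n = (X *v (\<chi> k. Y $ k $ n)) $ m"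
  by (simp add: matrix_matrix_mult_def matrix_vector_mult_def)

text \<open>Entries of \<open>K\<close> depend only on the label difference modulo N; hence
  \<open>K\<close> commutes with the cyclic shift.\<close>

lemma A_K: "A ** K = K ** A"
proof -
  have "(A ** K) $ m $ n = (K ** A) $ m $ n" for m n
  proof -
    have "(K ** A) $ m $ n = (transpose A *v (K $ m)) $ n"
      by (simp add: matrix_matrix_mult_def matrix_vector_mult_def transpose_def mult_ac)
    also have "\<dots> = (A ** K) $ m $ n"
      unfolding At_mult_nth matrix_mult_column A_mult_nth
      using kernel_nxt[of m "- real (\<iota> n)"] by (simp add: K_def kernel_prv_minus algebra_simps)
    finally show ?thesis ..
  qed
  then show ?thesis by (simp add: vec_eq_iff)
qed

text \<open>\<open>transpose A ** A\<close> is minus the discrete Laplacian on the cycle. It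
  multiplies the j-th cosine mode by its eigenvalue \<open>eig_mu CARD('n) j\<close>, cancelling the
  weight in the kernel; the remaining sum over nonconstant modes is the identity minus the averaging
  projection.\<close>

lemma AtA_K: "transpose A ** (A ** K) = centering_M"
proof -
  have "(transpose A ** (A ** K)) $ m $ n = centering_M $ m $ n" for m n
  proof -
    define x where "x = int (\<iota> m) - int (\<iota> n)"
    have x: "int CARD('n) dvd x \<longleftrightarrow> m = n"
    proof
      assume "int CARD('n) dvd x"
      moreover have "\<bar>x\<bar> < int CARD('n)" using \<iota>_range[of m] \<iota>_range[of n] by (auto simp: x_def)
      ultimately have "x = 0" using dvd_imp_le_int[of x "int CARD('n)"] by (cases "x = 0") auto
      then show "m = n" by (simp add: x_def \<iota>_eq_iff)
    qed (simp add: x_def)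
    have col: "(\<chi> k. (A ** K) $ k $ n) = A *v (\<chi> k. K $ k $ n)"
      by (simp add: vec_eq_iff matrix_mult_column)
    have "(transpose A ** (A ** K)) $ m $ n
        = 2 * kernel (of_int x) - kernel (of_int x + 1) - kernel (of_int x - 1)"
      unfolding matrix_mult_column[of "transpose A"] col At_mult_nth A_mult_nth
      using kernel_nxt[of m "- real (\<iota> n)"] kernel_prv[of m "- real (\<iota> n)"]
      by (simp add: K_def x_def)
    also have "\<dots> = (\<Sum>j = 1..CARD('n) - 1. cos (2 * pi * real j * of_int x / CARD('n))) / CARD('n)"
    proof -
      have "2 * (cos (2 * pi * real j * of_int x / CARD('n)) / eig_mu CARD('n) j)
          - cos (2 * pi * real j * (of_int x + 1) / CARD('n)) / eig_mu CARD('n) j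
          - cos (2 * pi * real j * (of_int x - 1) / CARD('n)) / eig_mu CARD('n) j = cos (2 * pi * real j * of_int x / CARD('n))"
        if "j \<in> {1..CARD('n) - 1}" for j
      proof -
        define a b where "a = 2 * pi * real j * of_int x / CARD('n)" and "b = 2 * pi * real j / CARD('n)"
        have ab: "2 * pi * real j * (of_int x + 1) / CARD('n) = a + b" "2 * pi * real j * (of_int x - 1) / CARD('n) = a - b"
          by (simp_all add: a_def b_def add_divide_distrib diff_divide_distrib distrib_left right_diff_distrib)
        have mu: "eig_mu CARD('n) j = 2 - 2 * cos b" by (simp add: eig_mu_def b_def)
        have "2 * cos a - cos (a + b) - cos (a - b) = cos a * eig_mu CARD('n) j"
          unfolding mu by (simp add: cos_add cos_diff algebra_simps)
        moreover have "eig_mu CARD('n) j \<noteq> 0" using that by (intro eig_mu_nonzero) auto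
        ultimately show ?thesis
          unfolding ab a_def[symmetric] by (simp add: divide_simps)
      qed
      then have "(\<Sum>j = 1..CARD('n) - 1. 2 * (cos (2 * pi * real j * of_int x / CARD('n)) / eig_mu CARD('n) j)
          - cos (2 * pi * real j * (of_int x + 1) / CARD('n)) / eig_mu CARD('n) j
          - cos (2 * pi * real j * (of_int x - 1) / CARD('n)) / eig_mu CARD('n) j)
          = (\<Sum>j = 1..CARD('n) - 1. cos (2 * pi * real j * of_int x / CARD('n)))"
        by (rule sum.cong[OF refl])
      then show ?thesis
        unfolding kernel_def sum_subtractf sum_distrib_left[symmetric]
        by (simp add: diff_divide_distrib[symmetric])
    qed
    \<comment> \<open>Adding the mode j = 0 completes a full sum over roots of unity, which is N on
      the diagonal and 0 elsewhere; that added mode is the -1 on the right.\<close>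
    also have "(\<Sum>j = 1..CARD('n) - 1. cos (2 * pi * real j * of_int x / CARD('n))) = (if m = n then real CARD('n) else 0) - 1"
    proof -
      have "{..<CARD('n)} = insert 0 {1..CARD('n) - 1}" using card by auto
      then have "(\<Sum>j<CARD('n). cos (2 * pi * real j * of_int x / CARD('n))) = 1 + (\<Sum>j = 1..CARD('n) - 1. cos (2 * pi * real j * of_int x / CARD('n)))"
        by simp
      moreover have "(\<Sum>j<CARD('n). cos (2 * pi * real j * of_int x / CARD('n))) = (if m = n then real CARD('n) else 0)"
      proof (cases "m = n")
        case True
        then show ?thesis by (simp add: x_def)
      next
        case False
        then show ?thesis using sum_cos_roots_of_unity[of "CARD('n)" x 0] x by simp
      qed
      ultimately show ?thesis by linarith
    qed
    also have "((if m = n then real CARD('n) else 0) - 1) / CARD('n) = centering_M $ m $ n"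
      using card by (simp add: centering_M_def mat_def diff_divide_distrib)
    finally show ?thesis .
  qed
  then show ?thesis by (simp add: vec_eq_iff)
qed

text \<open>Only nonconstant modes occur in the kernel, and each of them sums to zero around the
  cycle.\<close>

lemma K_const: "K *v (\<chi> n. c) = 0"
proof -
  have "(\<Sum>n\<in>UNIV. kernel (real (\<iota> m) - real (\<iota> n))) = 0" for m
  proof -
    have "(\<Sum>n\<in>UNIV. kernel (real (\<iota> m) - real (\<iota> n))) = (\<Sum>r\<in>{1..CARD('n)}. kernel (real (\<iota> m) - real r))"
      by (rule sum.reindex_bij_betw[OF bij])
    also have "\<dots> = (\<Sum>r<CARD('n). kernel (real (\<iota> m) - 1 - real r))"
      by (rule sum.reindex_bij_witness[of _ "\<lambda>r. r + 1" "\<lambda>r. r - 1"]) auto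
    also have "\<dots> = (\<Sum>j = 1..CARD('n) - 1. (\<Sum>r<CARD('n). cos (2 * pi * real j * (real (\<iota> m) - 1 - real r) / CARD('n))) / eig_mu CARD('n) j) / CARD('n)"
      unfolding kernel_def sum_divide_distrib[symmetric] by (subst sum.swap) (simp add: sum_divide_distrib)
    also have "\<dots> = 0"
    proof -
      have "(\<Sum>r<CARD('n). cos (2 * pi * real j * (real (\<iota> m) - 1 - real r) / CARD('n))) = 0" if "j \<in> {1..CARD('n) - 1}" for j
      proof -
        have "\<not> int CARD('n) dvd - int j" using that zdvd_imp_le[of "int CARD('n)" "int j"] by auto
        then have "(\<Sum>r<CARD('n). cos (2 * pi * real j * (real (\<iota> m) - 1) / CARD('n) + 2 * pi * real r * of_int (- int j) / CARD('n))) = 0"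
          by (intro sum_cos_roots_of_unity) simp_all
        then show ?thesis by (simp add: right_diff_distrib diff_divide_distrib mult_ac)
      qed
      then show ?thesis by simp
    qed
    finally show ?thesis .
  qed
  then show ?thesis by (simp add: vec_eq_iff K_def matrix_vector_mult_def sum_distrib_right[symmetric])
qed

text \<open>The product of the two Fourier entries depends on the label difference only. The real
  part gives the cosine kernel; in the imaginary part the sines for j and N - j cancel because their
  eigenvalues agree.\<close>

lemma mat_K_eq: "mat_K \<iota> $ m $ n = complex_of_real (K $ m $ n)"
proof -
  define x where "x = int (\<iota> m) - int (\<iota> n)"
  have root: "exp (2 * of_real pi * \<i> / of_nat CARD('n)) ^ k = cis (2 * pi * real k / CARD('n))" for k
  proof -
    have "exp (2 * of_real pi * \<i> / of_nat CARD('n)) = cis (2 * pi / CARD('n))"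
      unfolding cis_conv_exp by (rule arg_cong[of _ _ exp]) simp
    then show ?thesis by (simp add: Complex.DeMoivre mult_ac)
  qed
  have entry: "fourier_vec \<iota> j $ m * cnj (fourier_vec \<iota> j $ n) = cis (2 * pi * real j * of_int x / CARD('n)) / of_nat CARD('n)" for j
  proof -
    have "fourier_vec \<iota> j $ m * cnj (fourier_vec \<iota> j $ n)
        = cis (2 * pi * real ((\<iota> m - 1) * j) / CARD('n)) * cis (- (2 * pi * real ((\<iota> n - 1) * j) / CARD('n))) / (of_real (sqrt CARD('n)) * of_real (sqrt CARD('n)))"
      unfolding fourier_vec_def root by (simp add: cis_cnj)
    also have "\<dots> = cis (2 * pi * real ((\<iota> m - 1) * j) / CARD('n) + - (2 * pi * real ((\<iota> n - 1) * j) / CARD('n))) / of_nat CARD('n)"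
      by (simp only: cis_mult of_real_mult[symmetric]) simp
    also have "2 * pi * real ((\<iota> m - 1) * j) / CARD('n) + - (2 * pi * real ((\<iota> n - 1) * j) / CARD('n)) = 2 * pi * real j * of_int x / CARD('n)"
      using \<iota>_range[of m] \<iota>_range[of n] card by (simp add: x_def of_nat_diff field_simps)
    finally show ?thesis .
  qed
  have "mat_K \<iota> $ m $ n = (\<Sum>j = 1..CARD('n) - 1. complex_of_real (1 / eig_mu CARD('n) j) * (cis (2 * pi * real j * of_int x / CARD('n)) / of_nat CARD('n)))"
    unfolding mat_K_def by (simp add: sum_component entry) (simp add: scaleR_conv_of_real)
  moreover have "Re \<dots> = K $ m $ n"
    by (simp add: K_def kernel_def x_def sum_divide_distrib mult_ac)
  moreover have "Im (\<Sum>j = 1..CARD('n) - 1. complex_of_real (1 / eig_mu CARD('n) j) * (cis (2 * pi * real j * of_int x / CARD('n)) / of_nat CARD('n))) = 0"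
  proof -
    define f where "f j = sin (2 * pi * real j * of_int x / CARD('n)) / (CARD('n) * eig_mu CARD('n) j)" for j
    have "f (CARD('n) - j) = - f j" if "j \<in> {1..CARD('n) - 1}" for j
    proof -
      have "sin (2 * pi * real (CARD('n) - j) * of_int x / CARD('n)) = sin (2 * pi * of_int x - 2 * pi * real j * of_int x / CARD('n))"
      proof (intro arg_cong[of _ _ sin])
        have "real (CARD('n) - j) = real CARD('n) - real j" using that by (intro of_nat_diff) auto
        then show "2 * pi * real (CARD('n) - j) * of_int x / CARD('n) = 2 * pi * of_int x - 2 * pi * real j * of_int x / CARD('n)"
          by (simp add: field_simps)
      qed
      also have "\<dots> = - sin (2 * pi * real j * of_int x / CARD('n))"
        using sin_int_2pin[of x] cos_int_2pin[of x] by (simp add: sin_diff)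
      finally have "sin (2 * pi * real (CARD('n) - j) * of_int x / CARD('n)) = - sin (2 * pi * real j * of_int x / CARD('n))" .
      moreover have "eig_mu CARD('n) (CARD('n) - j) = eig_mu CARD('n) j" using that by (intro eig_mu_sym) auto
      ultimately show ?thesis by (simp only: f_def minus_divide_left)
    qed
    then have "(\<Sum>j = 1..CARD('n) - 1. f (CARD('n) - j)) = (\<Sum>j = 1..CARD('n) - 1. - f j)" by (rule sum.cong[OF refl])
    moreover have "(\<Sum>j = 1..CARD('n) - 1. f (CARD('n) - j)) = (\<Sum>j = 1..CARD('n) - 1. f j)"
      by (rule sum.reindex_bij_witness[of _ "\<lambda>j. CARD('n) - j" "\<lambda>j. CARD('n) - j"]) auto
    ultimately have "(\<Sum>j = 1..CARD('n) - 1. f j) = 0" by (simp add: sum_negf)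
    then show ?thesis by (simp add: f_def mult_ac)
  qed
  ultimately show ?thesis by (simp only: complex_eq_iff complex.sel Re_complex_of_real Im_complex_of_real)
qed

end

section \<open>Decay of the adjoint flow\<close>

lemma stack_nth [simp]: "stack u v $ Inl k = u $ k" "stack u v $ Inr l = v $ l"
  by (simp_all add: stack_def)

lemma stack_eq_iff: "x = stack u v \<longleftrightarrow> (\<forall>k. x $ Inl k = u $ k) \<and> (\<forall>l. x $ Inr l = v $ l)"
  by (auto simp: vec_eq_iff stack_def split: sum.split)

definition upper :: "'a ^ ('m::finite + 'n::finite) \<Rightarrow> 'a ^ 'm" where "upper x = (\<chi> k. x $ Inl k)"

definition lower :: "'a ^ ('m::finite + 'n::finite) \<Rightarrow> 'a ^ 'n" where "lower x = (\<chi> k. x $ Inr k)"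

lemma upper_lower_nth [simp]: "upper x $ k = x $ Inl k" "lower x $ l = x $ Inr l"
  by (simp_all add: upper_def lower_def)

lemma upper_lower_stack [simp]: "upper (stack u v) = u" "lower (stack u v) = v" "stack (upper x) (lower x) = x"
  by (simp_all add: vec_eq_iff) (metis stack_eq_iff upper_lower_nth)

lemma sum_UNIV_Plus: "(\<Sum>i\<in>(UNIV :: ('m::finite + 'n::finite) set). f i) = (\<Sum>k\<in>UNIV. f (Inl k)) + (\<Sum>l\<in>UNIV. f (Inr l))"
  using sum.Plus[of "UNIV :: 'm set" "UNIV :: 'n set" f] by (simp add: UNIV_Plus_UNIV)

lemma inner_stack: "x \<bullet> stack u v = upper x \<bullet> u + lower x \<bullet> v"
  by (simp add: inner_vec_def sum_UNIV_Plus)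

lemma stack_mult: "stack S T *v x = stack (S *v x) (T *v x)"
  by (simp add: stack_eq_iff matrix_vector_mult_def)

lemma block_mat_mult: "block_mat S T U V *v stack q p = stack (S *v q + T *v p) (U *v q + V *v p)"
  by (simp add: stack_eq_iff matrix_vector_mult_def block_mat_def sum_UNIV_Plus)

lemma transpose_block_mat:
  "transpose (block_mat S T U V) = block_mat (transpose S) (transpose U) (transpose T) (transpose V)"
proof -
  have "transpose (block_mat S T U V) $ i $ j = block_mat (transpose S) (transpose U) (transpose T) (transpose V) $ i $ j" for i j
    by (cases i; cases j) (simp_all add: transpose_def block_mat_def)
  then show ?thesis by (simp add: vec_eq_iff)
qed

lemma transpose_stack_mult: "transpose (stack S T) *v stack q p = transpose S *v q + transpose T *v p"
  by (simp add: vec_eq_iff matrix_vector_mult_def transpose_def sum_UNIV_Plus)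

lemma transpose_uminus: "transpose (- X) = - transpose X" for X :: "real^'n^'m"
  by (simp add: transpose_def vec_eq_iff)

lemma uminus_matrix_vector: "(- X) *v x = - (X *v x)" for X :: "real^'n::finite^'m::finite"
  by (simp add: matrix_vector_mult_def vec_eq_iff sum_negf)

text \<open>Gronwall's argument: the differential inequality says that exp(ct) V(t) is
  nonincreasing.\<close>

lemma exponential_decay:
  fixes V :: "real \<Rightarrow> real"
  assumes V: "\<And>t. (V has_real_derivative V' t) (at t)" and le: "\<And>t. V' t \<le> - (c * V t)" and "0 \<le> t"
  shows "V t \<le> V 0 * exp (- (c * t))"
proof -
  have "exp (c * t) * V t \<le> exp (c * 0) * V 0"
  proof (rule DERIV_nonpos_imp_nonincreasing[OF \<open>0 \<le> t\<close>])
    fix s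
    have "((\<lambda>s. exp (c * s) * V s) has_real_derivative exp (c * s) * (c * V s + V' s)) (at s)"
      by (auto intro!: derivative_eq_intros V simp: algebra_simps)
    moreover have "exp (c * s) * (c * V s + V' s) \<le> 0"
      using le[of s] by (intro mult_nonneg_nonpos) auto
    ultimately show "\<exists>y. ((\<lambda>s. exp (c * s) * V s) has_real_derivative y) (at s) \<and> y \<le> 0" by blast
  qed
  then have "exp (- (c * t)) * (exp (c * t) * V t) \<le> exp (- (c * t)) * V 0" by (intro mult_left_mono) auto
  then show ?thesis by (simp add: exp_minus field_simps)
qed

context ring_numbering
begin

section \<open>The adjoint drift and the algebra of \<open>A\<close>, \<open>K\<close> and
  \<open>M\<close>\<close>

abbreviation M :: "real ^ 'n ^ 'n" where "M \<equiv> centering_M"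

lemma drift_B_mult:
  "drift_B \<iota> \<alpha> \<beta> *v stack q p
    = stack (A *v p) (- (\<alpha>\<^sup>2 *\<^sub>R (transpose A *v q)) - \<beta> *\<^sub>R (transpose A *v (A *v p)))"
  by (simp add: drift_B_def block_mat_mult uminus_matrix_vector scaleR_matrix_vector_assoc[symmetric]
      matrix_vector_mul_assoc del: transpose_matrix_vector)

lemma transpose_drift_B_mult:
  "transpose (drift_B \<iota> \<alpha> \<beta>) *v stack a b
    = stack (- (\<alpha>\<^sup>2 *\<^sub>R (A *v b))) (transpose A *v a - \<beta> *\<^sub>R (transpose A *v (A *v b)))"
proof -
  have "transpose (0 :: real^'n^'n) = 0" by (simp add: transpose_def vec_eq_iff)
  then show ?thesis
    by (simp add: drift_B_def transpose_block_mat block_mat_mult uminus_matrix_vector scaleR_matrix_vector_assoc[symmetric]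
      transpose_uminus transpose_scalar matrix_transpose_mul matrix_vector_mul_assoc del: transpose_matrix_vector)
qed

lemma inner_A: "x \<bullet> (A *v y) = (transpose A *v x) \<bullet> y"
  by (simp add: dot_lmul_matrix transpose_matrix_vector)

lemma inner_K: "x \<bullet> (K *v y) = (K *v x) \<bullet> y"
  using K_sym by (metis dot_lmul_matrix transpose_matrix_vector)

lemma M_sym: "transpose M = M"
  by (simp add: centering_M_def transpose_def vec_eq_iff mat_def)

lemma inner_M: "x \<bullet> (M *v y) = (M *v x) \<bullet> y"
  using M_sym by (metis dot_lmul_matrix transpose_matrix_vector)

lemma M_decomp: "v = M *v v + (\<chi> k. (\<Sum>k\<in>UNIV. v $ k) / CARD('n))"
  by (simp add: vec_eq_iff M_mult_nth)

lemma M_idem: "M *v (M *v v) = M *v v"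
  by (simp add: vec_eq_iff M_mult_nth sum_subtractf)

lemma M_A: "M *v (A *v v) = A *v v"
  by (simp add: vec_eq_iff M_mult_nth sum_A)

lemma At_M: "transpose A *v (M *v v) = transpose A *v v"
  by (simp add: vec_eq_iff At_mult_nth M_mult_nth del: transpose_matrix_vector)

lemma K_M: "K *v (M *v v) = K *v v"
  using arg_cong[OF M_decomp[of v], of "(*v) K"] by (simp add: matrix_vector_right_distrib K_const)

lemma A_K_vec: "A *v (K *v v) = K *v (A *v v)"
  using A_K by (simp add: matrix_vector_mul_assoc)

lemma AtA_K_vec: "transpose A *v (A *v (K *v v)) = M *v v"
  using AtA_K by (simp add: matrix_vector_mul_assoc del: transpose_matrix_vector)

text \<open>The adjoint of \<open>AtA_K_vec\<close>: \<open>K\<close>, \<open>M\<close> and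
  \<open>transpose A ** A\<close> are symmetric, so the factors may be reversed.\<close>

lemma K_AtA_vec: "K *v (transpose A *v (A *v v)) = M *v v"
proof -
  have "x \<bullet> (K *v (transpose A *v (A *v v))) = x \<bullet> (M *v v)" for x
    by (metis AtA_K_vec inner_A inner_K inner_M inner_commute)
  then show ?thesis by (metis vector_eq_rdot inner_commute)
qed

lemma norm_At: "norm (transpose A *v v) = norm (A *v v)"
proof -
  have "(transpose A *v v) \<bullet> (transpose A *v v) = (A *v v) \<bullet> (A *v v)"
    by (metis A_normal inner_A inner_commute)
  then show ?thesis by (simp add: norm_eq_sqrt_inner)
qed

text \<open>Because K = K A^T A K, the matrix \<open>A ** K\<close> is an explicit factor of
  \<open>K\<close>. This shows positivity and provides the factor from which the Gaussian limit is
  constructed.\<close>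

lemma inner_K_eq: "v \<bullet> (K *v v) = (norm (A *v (K *v v)))\<^sup>2"
proof -
  have "(norm (A *v (K *v v)))\<^sup>2 = (K *v v) \<bullet> (M *v v)"
    by (metis AtA_K_vec inner_A inner_commute power2_norm_eq_inner)
  also have "\<dots> = v \<bullet> (K *v v)" by (metis K_M inner_K inner_commute)
  finally show ?thesis ..
qed

text \<open>A discrete Poincare inequality. The identity M v = K A^T (A v) recovers the centered
  part from the differences by a bounded map; the added 1 only makes the constant positive.\<close>

lemma poincare_A: obtains C where "0 < C" and "\<And>v. norm (M *v v) \<le> C * norm (A *v v)"
proof -
  define C where "C = onorm ((*v) (K ** transpose A)) + 1"
  have pos: "0 \<le> onorm ((*v) (K ** transpose A))"
    by (intro onorm_pos_le matrix_vector_mul_bounded_linear)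
  have "norm (M *v v) \<le> C * norm (A *v v)" for v
  proof -
    have "norm (M *v v) = norm ((K ** transpose A) *v (A *v v))"
      by (simp only: K_AtA_vec[symmetric] matrix_vector_mul_assoc matrix_mul_assoc)
    also have "\<dots> \<le> onorm ((*v) (K ** transpose A)) * norm (A *v v)"
      by (intro onorm matrix_vector_mul_bounded_linear)
    finally show ?thesis by (simp add: C_def distrib_right add_increasing2)
  qed
  moreover have "0 < C" using pos by (simp add: C_def)
  ultimately show thesis using that by blast
qed

text \<open>
  The energy \<open>\<bar>a\<bar>\<^sup>2 / \<alpha>\<^sup>2 + \<bar>b\<bar>\<^sup>2\<close> is only dissipated through \<open>A b\<close>; subtracting a small multiple of
  \<open>a \<bullet> A b\<close> makes it a strict Lyapunov function.
\<close>

lemma adjoint_decay: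
  assumes "0 < \<alpha>" "0 < \<beta>"
    and a: "\<And>t. (a has_vector_derivative - (\<alpha>\<^sup>2 *\<^sub>R (A *v b t))) (at t)"
    and b: "\<And>t. (b has_vector_derivative transpose A *v a t - \<beta> *\<^sub>R (transpose A *v (A *v b t))) (at t)"
  shows "((\<lambda>t. M *v a t) \<longlongrightarrow> 0) at_top" and "((\<lambda>t. M *v b t) \<longlongrightarrow> 0) at_top"
proof -
  obtain C where C: "0 < C" "\<And>v. norm (M *v v) \<le> C * norm (A *v v)" using poincare_A by blast
  define \<kappa> where "\<kappa> = onorm ((*v) A)"
  have \<kappa>: "norm (A *v v) \<le> \<kappa> * norm v" for v unfolding \<kappa>_def by (intro onorm matrix_vector_mul_bounded_linear)
  have "0 \<le> \<kappa>" unfolding \<kappa>_def by (intro onorm_pos_le matrix_vector_mul_bounded_linear)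
  \<comment> \<open>The first bound makes the correction term at most half the energy, so
    \<open>V\<close> and \<open>E\<close> are comparable. The second lets the friction absorb what
    the correction adds to the \<open>(Y t)\<^sup>2\<close> terms.\<close>
  define \<epsilon> where "\<epsilon> = min (1 / (\<kappa> * \<alpha> + 1)) (\<beta> / (\<alpha>\<^sup>2 + \<beta>\<^sup>2 * \<kappa>\<^sup>2 / 2))"
  have denom: "0 < \<alpha>\<^sup>2 + \<beta>\<^sup>2 * \<kappa>\<^sup>2 / 2" using assms by (intro add_pos_nonneg) auto
  have "0 < \<epsilon>" using assms \<open>0 \<le> \<kappa>\<close> denom by (simp add: \<epsilon>_def add_nonneg_pos)
  have \<epsilon>1: "\<epsilon> * (\<kappa> * \<alpha>) \<le> 1"
  proof -
    have p: "0 < \<kappa> * \<alpha> + 1" using assms \<open>0 \<le> \<kappa>\<close> by (simp add: add_nonneg_pos)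
    have "\<epsilon> * (\<kappa> * \<alpha> + 1) \<le> 1 / (\<kappa> * \<alpha> + 1) * (\<kappa> * \<alpha> + 1)"
      using p by (intro mult_right_mono) (auto simp: \<epsilon>_def)
    also have "\<dots> = 1" using p by simp
    finally show ?thesis using \<open>0 < \<epsilon>\<close> by (simp add: distrib_left)
  qed
  have \<epsilon>2: "\<epsilon> * \<alpha>\<^sup>2 + \<epsilon> * (\<beta>\<^sup>2 * \<kappa>\<^sup>2) / 2 \<le> \<beta>"
  proof -
    have "\<epsilon> * (\<alpha>\<^sup>2 + \<beta>\<^sup>2 * \<kappa>\<^sup>2 / 2) \<le> \<beta> / (\<alpha>\<^sup>2 + \<beta>\<^sup>2 * \<kappa>\<^sup>2 / 2) * (\<alpha>\<^sup>2 + \<beta>\<^sup>2 * \<kappa>\<^sup>2 / 2)"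
      using denom by (intro mult_right_mono) (auto simp: \<epsilon>_def)
    also have "\<dots> = \<beta>" using denom by simp
    finally show ?thesis by (simp add: distrib_left)
  qed
  \<comment> \<open>Centering leaves the system unchanged, since \<open>A\<close> and its transpose
    annihilate constants and have mean-zero range. The Poincare inequality then bounds the full
    norms of \<open>x\<close> and \<open>y\<close>.\<close>
  define x y where "x t = M *v a t" and "y t = M *v b t" for t
  have x: "(x has_vector_derivative - (\<alpha>\<^sup>2 *\<^sub>R (A *v y t))) (at t)" for t
    using bounded_linear.has_vector_derivative[OF matrix_vector_mul_bounded_linear a, of M t]
    by (simp add: x_def[abs_def] y_def A_M M_A matrix_vector_mult_scaleR vec.neg)
  have y: "(y has_vector_derivative transpose A *v x t - \<beta> *\<^sub>R (transpose A *v (A *v y t))) (at t)" for t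
    using bounded_linear.has_vector_derivative[OF matrix_vector_mul_bounded_linear b, of M t]
    by (simp add: x_def y_def[abs_def] A_M M_At At_M matrix_vector_mult_scaleR matrix_vector_mult_diff_distrib
        del: transpose_matrix_vector)
  have xM: "M *v x t = x t" and yM: "M *v y t = y t" for t by (simp_all add: x_def y_def M_idem)
  define E where "E t = (norm (x t))\<^sup>2 / \<alpha>\<^sup>2 + (norm (y t))\<^sup>2" for t
  define V where "V t = (x t \<bullet> x t) / \<alpha>\<^sup>2 + y t \<bullet> y t - \<epsilon> * (x t \<bullet> (A *v y t))" for t
  define X Y where "X t = norm (transpose A *v x t)" and "Y t = norm (A *v y t)" for t
  \<comment> \<open>In the derivative of \<open>V\<close> the coupling terms x \<bullet> A y from
    the two halves of the energy cancel, thanks to the weight 1 / \<alpha>^2. The correction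
    contributes the damping -\<epsilon>X^2 that the energy alone lacks.\<close>
  define V' where "V' t = - (2 * \<beta> * (Y t)\<^sup>2) + \<epsilon> * \<alpha>\<^sup>2 * (Y t)\<^sup>2 - \<epsilon> * (X t)\<^sup>2
      + \<epsilon> * \<beta> * ((transpose A *v x t) \<bullet> (transpose A *v (A *v y t)))" for t
  have V_deriv: "(V has_real_derivative V' t) (at t)" for t
  proof -
    define x' y' where "x' = - (\<alpha>\<^sup>2 *\<^sub>R (A *v y t))" and "y' = transpose A *v x t - \<beta> *\<^sub>R (transpose A *v (A *v y t))"
    have ip: "((\<lambda>t. f t \<bullet> g t) has_real_derivative f t \<bullet> g' + f' \<bullet> g t) (at t)"
      if "(f has_vector_derivative f') (at t)" "(g has_vector_derivative g') (at t)" for f g :: "real \<Rightarrow> real^'n" and f' g'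
      using bounded_bilinear.has_vector_derivative[OF bounded_bilinear_inner that]
      by (simp add: has_real_derivative_iff_has_vector_derivative)
    note x1 = x[of t, folded x'_def] and y1 = y[of t, folded y'_def]
    note Ay = bounded_linear.has_vector_derivative[OF matrix_vector_mul_bounded_linear[of A] y1]
    have "(V has_real_derivative (x t \<bullet> x' + x' \<bullet> x t) / \<alpha>\<^sup>2 + (y t \<bullet> y' + y' \<bullet> y t)
        - \<epsilon> * (x t \<bullet> (A *v y') + x' \<bullet> (A *v y t))) (at t)"
      unfolding V_def[abs_def] by (intro DERIV_diff DERIV_add DERIV_cdivide DERIV_cmult ip x1 y1 Ay)
    also have "(x t \<bullet> x' + x' \<bullet> x t) / \<alpha>\<^sup>2 = - 2 * (x t \<bullet> (A *v y t))"
      using \<open>0 < \<alpha>\<close> by (simp add: x'_def inner_commute)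
    also have "y t \<bullet> y' + y' \<bullet> y t = 2 * (x t \<bullet> (A *v y t)) - 2 * \<beta> * (Y t)\<^sup>2"
    proof -
      have "(transpose A *v (A *v y t)) \<bullet> y t = (Y t)\<^sup>2"
        by (simp only: inner_A[symmetric] Y_def power2_norm_eq_inner)
      then have "y' \<bullet> y t = x t \<bullet> (A *v y t) - \<beta> * (Y t)\<^sup>2"
        by (simp only: y'_def inner_diff_left inner_scaleR_left inner_A[symmetric])
      then show ?thesis by (simp add: inner_commute)
    qed
    also have "x t \<bullet> (A *v y') + x' \<bullet> (A *v y t)
        = (X t)\<^sup>2 - \<beta> * ((transpose A *v x t) \<bullet> (transpose A *v (A *v y t))) - \<alpha>\<^sup>2 * (Y t)\<^sup>2"
    proof -
      have "x t \<bullet> (A *v y') = (X t)\<^sup>2 - \<beta> * ((transpose A *v x t) \<bullet> (transpose A *v (A *v y t)))"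
        by (simp only: inner_A y'_def inner_diff_right inner_scaleR_right X_def power2_norm_eq_inner)
      moreover have "x' \<bullet> (A *v y t) = - (\<alpha>\<^sup>2 * (Y t)\<^sup>2)"
        by (simp only: x'_def inner_minus_left inner_scaleR_left Y_def power2_norm_eq_inner)
      ultimately show ?thesis by simp
    qed
    finally show ?thesis by (simp add: V'_def algebra_simps del: transpose_matrix_vector)
  qed
  have E_V: "E t \<le> 2 * V t" "V t \<le> 2 * E t" for t
  proof -
    have "\<bar>\<epsilon> * (x t \<bullet> (A *v y t))\<bar> \<le> \<epsilon> * (norm (x t) * (\<kappa> * norm (y t)))"
      using \<open>0 < \<epsilon>\<close> Cauchy_Schwarz_ineq2[of "x t" "A *v y t"] mult_left_mono[OF \<kappa>[of "y t"], of "norm (x t)"]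
      by (simp add: abs_mult)
    also have "\<dots> = (\<epsilon> * (\<kappa> * \<alpha>)) * ((norm (x t) / \<alpha>) * norm (y t))" using \<open>0 < \<alpha>\<close> by simp
    also have "\<dots> \<le> 1 * ((norm (x t) / \<alpha>) * norm (y t))" using \<epsilon>1 \<open>0 < \<alpha>\<close> by (intro mult_right_mono) auto
    also have "\<dots> \<le> E t / 2"
      using sum_squares_bound[of "norm (x t) / \<alpha>" "norm (y t)"] by (simp add: E_def power_divide mult_ac)
    finally have "\<bar>\<epsilon> * (x t \<bullet> (A *v y t))\<bar> \<le> E t / 2" .
    moreover have "V t = E t - \<epsilon> * (x t \<bullet> (A *v y t))" by (simp add: V_def E_def power2_norm_eq_inner)
    moreover have "0 \<le> E t" by (simp add: E_def)
    ultimately show "E t \<le> 2 * V t" "V t \<le> 2 * E t" by linarith+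
  qed
  \<comment> \<open>By the Poincare inequality the dissipation \<epsilon>X^2 / 2 + \<beta>Y^2 is at
    least c E; the factor \<alpha>^2 compensates the weight of \<open>x\<close> in \<open>E\<close>.
    The rate becomes c / 2 because V \<le> 2E.\<close>
  define c where "c = min (\<epsilon> * \<alpha>\<^sup>2 / 2) \<beta> / C\<^sup>2"
  have "0 < c" using assms \<open>0 < \<epsilon>\<close> C(1) by (simp add: c_def)
  have V'_le: "V' t \<le> - (c / 2 * V t)" for t
  proof -
    \<comment> \<open>Young's inequality splits the mixed term: half of the damping -\<epsilon>X^2
      pays for its \<open>X\<close> part, and the choice of \<epsilon> leaves -\<beta>Y^2 after the
      rest is paid.\<close>
    have "(transpose A *v x t) \<bullet> (transpose A *v (A *v y t)) \<le> X t * (\<kappa> * Y t)"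
    proof -
      have "(transpose A *v x t) \<bullet> (transpose A *v (A *v y t)) \<le> X t * norm (transpose A *v (A *v y t))"
        unfolding X_def by (rule norm_cauchy_schwarz)
      also have "\<dots> \<le> X t * (\<kappa> * Y t)"
        unfolding norm_At Y_def by (intro mult_left_mono \<kappa>) (simp add: X_def)
      finally show ?thesis .
    qed
    then have "\<epsilon> * \<beta> * ((transpose A *v x t) \<bullet> (transpose A *v (A *v y t))) \<le> \<epsilon> * \<beta> * (X t * (\<kappa> * Y t))"
      using \<open>0 < \<epsilon>\<close> \<open>0 < \<beta>\<close> by (intro mult_left_mono) auto
    also have "\<dots> = \<epsilon> * (X t * (\<beta> * \<kappa> * Y t))" by simp
    also have "\<dots> \<le> \<epsilon> * (((X t)\<^sup>2 + (\<beta> * \<kappa> * Y t)\<^sup>2) / 2)"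
      using sum_squares_bound[of "X t" "\<beta> * \<kappa> * Y t"] \<open>0 < \<epsilon>\<close> by (intro mult_left_mono) auto
    also have "\<dots> = \<epsilon> * (X t)\<^sup>2 / 2 + (\<epsilon> * (\<beta>\<^sup>2 * \<kappa>\<^sup>2) / 2) * (Y t)\<^sup>2"
      by (simp add: power_mult_distrib algebra_simps add_divide_distrib)
    finally have "V' t \<le> - (\<epsilon> / 2 * (X t)\<^sup>2) + (\<epsilon> * \<alpha>\<^sup>2 + \<epsilon> * (\<beta>\<^sup>2 * \<kappa>\<^sup>2) / 2) * (Y t)\<^sup>2 - 2 * \<beta> * (Y t)\<^sup>2"
      unfolding V'_def by (simp add: algebra_simps del: transpose_matrix_vector)
    also have "\<dots> \<le> - (\<epsilon> / 2 * (X t)\<^sup>2) + \<beta> * (Y t)\<^sup>2 - 2 * \<beta> * (Y t)\<^sup>2"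
      using \<epsilon>2 by (intro diff_right_mono add_left_mono mult_right_mono) auto
    also have "\<dots> = - (\<epsilon> / 2 * (X t)\<^sup>2 + \<beta> * (Y t)\<^sup>2)" by simp
    also have "\<dots> \<le> - (c * E t)"
    proof -
      \<comment> \<open>The Poincare inequality is stated for \<open>A\<close>, whereas
        \<open>X t\<close> involves its transpose; normality of \<open>A\<close> makes the two norms
        equal.\<close>
      have X: "(norm (x t))\<^sup>2 \<le> C\<^sup>2 * (X t)\<^sup>2"
        using power_mono[OF C(2)[of "x t"], of 2] by (simp add: X_def norm_At xM power_mult_distrib del: transpose_matrix_vector)
      have Y: "(norm (y t))\<^sup>2 \<le> C\<^sup>2 * (Y t)\<^sup>2"
        using power_mono[OF C(2)[of "y t"], of 2] by (simp add: Y_def yM power_mult_distrib)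
      have c1: "c * C\<^sup>2 \<le> \<epsilon> * \<alpha>\<^sup>2 / 2" and c2: "c * C\<^sup>2 \<le> \<beta>" using C(1) by (auto simp: c_def)
      have "c * ((norm (x t))\<^sup>2 / \<alpha>\<^sup>2) \<le> \<epsilon> / 2 * (X t)\<^sup>2"
      proof -
        have "c * (norm (x t))\<^sup>2 \<le> c * (C\<^sup>2 * (X t)\<^sup>2)" using X \<open>0 < c\<close> by (intro mult_left_mono) auto
        also have "\<dots> = (c * C\<^sup>2) * (X t)\<^sup>2" by simp
        also have "\<dots> \<le> (\<epsilon> * \<alpha>\<^sup>2 / 2) * (X t)\<^sup>2" using c1 by (intro mult_right_mono) auto
        finally show ?thesis using \<open>0 < \<alpha>\<close> by (simp add: pos_divide_le_eq mult_ac)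
      qed
      moreover have "c * (norm (y t))\<^sup>2 \<le> \<beta> * (Y t)\<^sup>2"
      proof -
        have "c * (norm (y t))\<^sup>2 \<le> c * (C\<^sup>2 * (Y t)\<^sup>2)" using Y \<open>0 < c\<close> by (intro mult_left_mono) auto
        also have "\<dots> = (c * C\<^sup>2) * (Y t)\<^sup>2" by simp
        also have "\<dots> \<le> \<beta> * (Y t)\<^sup>2" using c2 by (intro mult_right_mono) auto
        finally show ?thesis .
      qed
      ultimately show ?thesis unfolding E_def distrib_left by linarith
    qed
    also have "\<dots> \<le> - (c / 2 * V t)"
      using mult_left_mono[OF E_V(2)[of t], of c] \<open>0 < c\<close> by simp
    finally show ?thesis .
  qed
  have lim: "((\<lambda>t. 2 * (V 0 * exp (- (c / 2 * t)))) \<longlongrightarrow> 0) at_top"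
  proof -
    have "filterlim (\<lambda>t. - (c / 2 * t)) at_bot at_top"
      using \<open>0 < c\<close> filterlim_tendsto_pos_mult_at_top[OF tendsto_const _ filterlim_ident, of "c / 2"]
      by (simp add: filterlim_uminus_at_bot)
    then have "((\<lambda>t. exp (- (c / 2 * t))) \<longlongrightarrow> 0) at_top" by (rule filterlim_compose[OF exp_at_bot])
    then show ?thesis using tendsto_mult_right_zero by blast
  qed
  have "(E \<longlongrightarrow> 0) at_top"
  proof (rule tendsto_sandwich[OF _ _ tendsto_const lim])
    show "\<forall>\<^sub>F t in at_top. E t \<le> 2 * (V 0 * exp (- (c / 2 * t)))"
      using eventually_ge_at_top[of 0]
    proof eventually_elim
      case (elim t)
      then show ?case using exponential_decay[OF V_deriv V'_le, of t] E_V(1)[of t] by linarith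
    qed
  qed (simp add: E_def)
  then have lim_sqrt: "((\<lambda>t. sqrt (E t)) \<longlongrightarrow> 0) at_top" using tendsto_real_sqrt by fastforce
  have nx: "norm (x t) \<le> \<alpha> * sqrt (E t)" for t
  proof -
    have "\<bar>norm (x t) / \<alpha>\<bar> \<le> sqrt (E t)" by (intro real_le_rsqrt) (simp add: E_def power_divide)
    then show ?thesis using \<open>0 < \<alpha>\<close> by (simp add: pos_divide_le_eq mult.commute)
  qed
  have ny: "norm (y t) \<le> sqrt (E t)" for t
    by (intro real_le_rsqrt) (simp add: E_def)
  show "((\<lambda>t. M *v a t) \<longlongrightarrow> 0) at_top"
    using nx unfolding x_def by (intro Lim_null_comparison[OF _ tendsto_mult_right_zero[OF lim_sqrt, of \<alpha>]]) auto
  show "((\<lambda>t. M *v b t) \<longlongrightarrow> 0) at_top"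
    using ny unfolding y_def by (intro Lim_null_comparison[OF _ lim_sqrt]) auto
qed

end

section \<open>The stationary limit\<close>

text \<open>Along any sequence of times tending to infinity, the joint characteristic function at
  \<open>u\<close> is that of the functional at 1. It is explicit in mean and variance and converges
  with them, so the continuity theorem applies.\<close>

lemma converges_in_distribution_normal:
  fixes X :: "real \<Rightarrow> 'w \<Rightarrow> real ^ 'd::finite"
  assumes P: "prob_space P" and X: "\<And>t. 0 < t \<Longrightarrow> X t \<in> borel_measurable P"
    and \<nu>: "prob_space \<nu>" "sets \<nu> = sets borel"
    and normal: "\<And>u t. 0 < t \<Longrightarrow> distr P borel (\<lambda>\<omega>. u \<bullet> X t \<omega>) = normal_real (m u t) (sqrt (v u t))"
    and v: "\<And>u t. 0 < t \<Longrightarrow> 0 \<le> v u t"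
    and m_lim: "\<And>u. (m u \<longlongrightarrow> m' u) at_top" and v_lim: "\<And>u. (v u \<longlongrightarrow> v' u) at_top"
    and \<nu>_normal: "\<And>u. distr \<nu> borel (\<lambda>x. u \<bullet> x) = normal_real (m' u) (sqrt (v' u))"
  shows "converges_in_distribution P X \<nu>"
  unfolding converges_in_distribution_def
proof (intro allI impI, elim conjE)
  fix f :: "real ^ 'd \<Rightarrow> real" assume f: "continuous_on UNIV f" and "bounded (range f)"
  then obtain b where b: "\<And>x. \<bar>f x\<bar> \<le> b" by (auto simp: bounded_iff)
  interpret P: prob_space P by (rule P)
  interpret \<nu>: prob_space \<nu> by (rule \<nu>)
  show "((\<lambda>t. \<integral>y. f y \<partial>distr P borel (X t)) \<longlongrightarrow> (\<integral>y. f y \<partial>\<nu>)) at_top"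
  proof (rule tendsto_at_topI_sequentially)
    fix \<tau> :: "nat \<Rightarrow> real" assume \<tau>: "filterlim \<tau> at_top sequentially"
    \<comment> \<open>The normality hypothesis covers positive times only. Truncation makes every
      time positive and alters only finitely many terms.\<close>
    define \<tau>' where "\<tau>' n = max 1 (\<tau> n)" for n
    have pos: "0 < \<tau>' n" for n by (simp add: \<tau>'_def)
    have eq: "\<forall>\<^sub>F n in sequentially. \<tau>' n = \<tau> n"
      using filterlim_at_top_dense[THEN iffD1, OF \<tau>, rule_format, of 1]
      by eventually_elim (simp add: \<tau>'_def)
    have \<tau>': "filterlim \<tau>' at_top sequentially"
      using \<tau> by (rule filterlim_cong[THEN iffD2, OF refl refl eq])
    have "(\<lambda>n. \<integral>y. f y \<partial>distr P borel (X (\<tau>' n))) \<longlonglongrightarrow> (\<integral>y. f y \<partial>\<nu>)"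
    proof (rule levy_continuity_vec[OF _ _ \<nu> _ f b])
      show "prob_space (distr P borel (X (\<tau>' n)))" for n by (rule P.prob_space_distr) (rule X[OF pos])
      fix u
      have "((\<lambda>t. iexp (m u t) * of_real (exp (- v u t / 2))) \<longlongrightarrow> iexp (m' u) * of_real (exp (- v' u / 2))) at_top"
        by (intro tendsto_intros m_lim v_lim) auto
      then have lim: "(\<lambda>n. iexp (m u (\<tau>' n)) * of_real (exp (- v u (\<tau>' n) / 2)))
          \<longlonglongrightarrow> iexp (m' u) * of_real (exp (- v' u / 2))"
        using \<tau>' by (rule filterlim_compose)
      have v_inf: "0 \<le> v' u"
        using v_lim by (rule tendsto_lowerbound) (auto intro: eventually_mono[OF eventually_gt_at_top[of 0] v])
      have "(\<integral>x. iexp (u \<bullet> x) \<partial>distr P borel (X (\<tau>' n))) = char (distr P borel (\<lambda>\<omega>. u \<bullet> X (\<tau>' n) \<omega>)) 1" for n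
        using X[OF pos, of n] unfolding char_def by (simp add: integral_distr)
      moreover have "(\<integral>x. iexp (u \<bullet> x) \<partial>\<nu>) = char (distr \<nu> borel (\<lambda>x. u \<bullet> x)) 1"
        unfolding char_def by (subst integral_distr) (auto simp: measurable_cong_sets[OF \<nu>(2) refl])
      ultimately show "(\<lambda>n. \<integral>x. iexp (u \<bullet> x) \<partial>distr P borel (X (\<tau>' n))) \<longlonglongrightarrow> (\<integral>x. iexp (u \<bullet> x) \<partial>\<nu>)"
        using lim v_inf by (simp add: \<nu>_normal normal pos v char_normal_real)
    qed simp
    then show "(\<lambda>n. \<integral>y. f y \<partial>distr P borel (X (\<tau> n))) \<longlonglongrightarrow> (\<integral>y. f y \<partial>\<nu>)"
      by (rule Lim_transform_eventually) (use eq in \<open>auto elim: eventually_mono\<close>)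
  qed
qed

context ring_numbering
begin

text \<open>The block diagonal matrix D = diag(I, M) commutes with the drift, because A M = A and M
  A^T = A^T. Being linear and continuous, it can be applied to the integral equation path by
  path.\<close>

lemma solves_centered:
  assumes Z: "solves_linear_sde P (drift_B \<iota> \<alpha> \<beta>) (diffusion_G \<sigma>) W (stack q\<^sub>0 p\<^sub>0) (\<lambda>t \<omega>. stack (Q t \<omega>) (p t \<omega>))"
  shows "solves_linear_sde P (drift_B \<iota> \<alpha> \<beta>) (stack 0 (\<sigma> *\<^sub>R M)) W (stack q\<^sub>0 (M *v p\<^sub>0)) (\<lambda>t \<omega>. stack (Q t \<omega>) (M *v p t \<omega>))"
proof -
  define B where "B = drift_B \<iota> \<alpha> \<beta>"
  define D :: "real ^ ('n + 'n) ^ ('n + 'n)" where "D = block_mat (mat 1) 0 0 M"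
  define Z where "Z t \<omega> = stack (Q t \<omega>) (p t \<omega>)" for t \<omega>
  have D: "D *v stack q r = stack q (M *v r)" for q r by (simp add: D_def block_mat_mult)
  have DB: "D *v (B *v x) = B *v (D *v x)" for x
  proof -
    have "D *v (B *v stack q r) = B *v (D *v stack q r)" for q r
      unfolding B_def D drift_B_mult
      by (simp add: A_M M_At matrix_vector_mult_diff_distrib matrix_vector_mult_scaleR vec.neg del: transpose_matrix_vector)
    from this[of "upper x" "lower x"] show ?thesis by simp
  qed
  have DG: "D *v (diffusion_G \<sigma> *v w) = stack 0 (\<sigma> *\<^sub>R M) *v w" for w
    by (simp add: diffusion_G_def stack_mult D scaleR_matrix_vector_assoc[symmetric] matrix_vector_mult_scaleR)
  have lin: "bounded_linear (\<lambda>x. D *v x)" by (rule matrix_vector_mul_bounded_linear)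
  have [measurable]: "(\<lambda>x. D *v x) \<in> borel_measurable borel"
    using lin by (intro borel_measurable_continuous_onI linear_continuous_on)
  have Z_meas[measurable]: "Z t \<in> borel_measurable P" if "0 \<le> t" for t
    using Z that by (simp add: solves_linear_sde_def Z_def[abs_def])
  have X: "(\<lambda>t \<omega>. stack (Q t \<omega>) (M *v p t \<omega>)) = (\<lambda>t \<omega>. D *v Z t \<omega>)" by (simp add: D Z_def)
  have "AE \<omega> in P. continuous_on {0..} (\<lambda>t. Z t \<omega>) \<and>
      (\<forall>t\<ge>0. Z t \<omega> = stack q\<^sub>0 p\<^sub>0 + integral {0..t} (\<lambda>s. B *v Z s \<omega>) + diffusion_G \<sigma> *v W t \<omega>)"
    using Z by (simp add: solves_linear_sde_def B_def Z_def)
  then have "AE \<omega> in P. continuous_on {0..} (\<lambda>t. D *v Z t \<omega>) \<and>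
      (\<forall>t\<ge>0. D *v Z t \<omega> = stack q\<^sub>0 (M *v p\<^sub>0) + integral {0..t} (\<lambda>s. B *v (D *v Z s \<omega>)) + stack 0 (\<sigma> *\<^sub>R M) *v W t \<omega>)"
  proof eventually_elim
    case (elim \<omega>)
    have "D *v integral {0..t} (\<lambda>s. B *v Z s \<omega>) = integral {0..t} (\<lambda>s. B *v (D *v Z s \<omega>))" for t
    proof -
      have "(\<lambda>s. B *v Z s \<omega>) integrable_on {0..t}"
        using elim by (intro integrable_continuous_real bounded_linear.continuous_on[OF matrix_vector_mul_bounded_linear])
          (auto elim: continuous_on_subset)
      from integral_linear[OF this lin] show ?thesis by (simp add: comp_def DB)
    qed
    then show ?case
      using elim by (auto simp: matrix_vector_right_distrib D DG intro!: bounded_linear.continuous_on[OF lin])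
  qed
  then show ?thesis unfolding solves_linear_sde_def X B_def by (auto intro!: measurable_compose[OF Z_meas])
qed

text \<open>The asserted covariance in real form, with \<open>K\<close> in place of the complex
  \<open>mat_K\<close>, so that it can be compared with \<open>cov_mat\<close> and used in real
  inner products.\<close>

definition limit_cov :: "real \<Rightarrow> real \<Rightarrow> real \<Rightarrow> real ^ ('n + 'n) ^ ('n + 'n)" where
  "limit_cov \<alpha> \<beta> \<sigma> = block_mat ((\<sigma>\<^sup>2 / (2 * \<alpha>\<^sup>2 * \<beta>)) *\<^sub>R K) 0 0 ((\<sigma>\<^sup>2 / (2 * \<beta>)) *\<^sub>R K)"

lemma limit_cov_mult:
  "limit_cov \<alpha> \<beta> \<sigma> *v stack a b = stack ((\<sigma>\<^sup>2 / (2 * \<alpha>\<^sup>2 * \<beta>)) *\<^sub>R (K *v a)) ((\<sigma>\<^sup>2 / (2 * \<beta>)) *\<^sub>R (K *v b))"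
  by (simp add: limit_cov_def block_mat_mult scaleR_matrix_vector_assoc[symmetric])

lemma limit_cov_form:
  "u \<bullet> (limit_cov \<alpha> \<beta> \<sigma> *v u)
    = \<sigma>\<^sup>2 / (2 * \<alpha>\<^sup>2 * \<beta>) * (upper u \<bullet> (K *v upper u)) + \<sigma>\<^sup>2 / (2 * \<beta>) * (lower u \<bullet> (K *v lower u))"
  using limit_cov_mult[of \<alpha> \<beta> \<sigma> "upper u" "lower u"] by (simp add: inner_stack)

lemma limit_cov_sym: "transpose (limit_cov \<alpha> \<beta> \<sigma>) = limit_cov \<alpha> \<beta> \<sigma>"
proof -
  have "transpose (0 :: real^'n^'n) = 0" by (simp add: transpose_def vec_eq_iff)
  then show ?thesis by (simp add: limit_cov_def transpose_block_mat transpose_scalar K_sym)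
qed

text \<open>The factor \<open>A ** K\<close> of \<open>K\<close>, scaled in each block, exhibits the
  covariance as R^T R, the form needed for constructing the limit law.\<close>

lemma limit_cov_sqrt:
  assumes "0 < \<alpha>" "0 < \<beta>"
  obtains R :: "real ^ ('n + 'n) ^ ('n + 'n)" where "\<And>u. u \<bullet> (limit_cov \<alpha> \<beta> \<sigma> *v u) = (norm (R *v u))\<^sup>2"
proof -
  define c\<^sub>1 c\<^sub>2 where "c\<^sub>1 = \<sigma>\<^sup>2 / (2 * \<alpha>\<^sup>2 * \<beta>)" and "c\<^sub>2 = \<sigma>\<^sup>2 / (2 * \<beta>)"
  have c: "0 \<le> c\<^sub>1" "0 \<le> c\<^sub>2" using assms by (simp_all add: c\<^sub>1_def c\<^sub>2_def)
  define R :: "real ^ ('n + 'n) ^ ('n + 'n)" where "R = block_mat (sqrt c\<^sub>1 *\<^sub>R (A ** K)) 0 0 (sqrt c\<^sub>2 *\<^sub>R (A ** K))"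
  have "u \<bullet> (limit_cov \<alpha> \<beta> \<sigma> *v u) = (norm (R *v u))\<^sup>2" for u
  proof -
    have "R *v stack (upper u) (lower u)
        = stack (sqrt c\<^sub>1 *\<^sub>R (A *v (K *v upper u))) (sqrt c\<^sub>2 *\<^sub>R (A *v (K *v lower u)))"
      unfolding R_def by (simp only: block_mat_mult scaleR_matrix_vector_assoc[symmetric] matrix_vector_mul_assoc) simp
    then have "(norm (R *v u))\<^sup>2 = c\<^sub>1 * (upper u \<bullet> (K *v upper u)) + c\<^sub>2 * (lower u \<bullet> (K *v lower u))"
      unfolding inner_K_eq using c by (simp add: power2_norm_eq_inner inner_stack mult.assoc[symmetric])
    then show ?thesis by (simp add: limit_cov_form c\<^sub>1_def c\<^sub>2_def)
  qed
  then show thesis by (rule that)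
qed

text \<open>This is the quadratic form of the Lyapunov equation for \<open>\<Sigma>\<close> and the drift matrix.\<close>

lemma limit_cov_lyapunov:
  assumes "0 < \<alpha>" "0 < \<beta>"
  shows "2 * (x \<bullet> (limit_cov \<alpha> \<beta> \<sigma> *v (transpose (drift_B \<iota> \<alpha> \<beta>) *v x)))
    = - (norm (transpose (stack 0 (\<sigma> *\<^sub>R M)) *v x))\<^sup>2"
proof -
  define a b where "a = upper x" and "b = lower x"
  have x: "x = stack a b" by (simp add: a_def b_def)
  \<comment> \<open>The coupling of the two blocks. It enters with -\<sigma>^2 / (2\<beta>) from the
    upper and +\<sigma>^2 / (2\<beta>) from the lower block and cancels; this fixes the ratio 1 /
    \<alpha>^2 of the two blocks.\<close>
  define k where "k = a \<bullet> (K *v (A *v b))"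
  have KAt: "b \<bullet> (K *v (transpose A *v a)) = k"
    by (metis A_K_vec inner_A inner_K inner_commute k_def)
  have "norm (transpose (stack 0 (\<sigma> *\<^sub>R M)) *v x) = \<bar>\<sigma>\<bar> * norm (M *v b)"
    unfolding x transpose_stack_mult by (simp add: transpose_scalar M_sym scaleR_matrix_vector_assoc[symmetric])
  moreover have "b \<bullet> (M *v b) = (norm (M *v b))\<^sup>2"
    by (metis M_idem inner_M power2_norm_eq_inner)
  moreover have "x \<bullet> (limit_cov \<alpha> \<beta> \<sigma> *v (transpose (drift_B \<iota> \<alpha> \<beta>) *v x))
      = \<sigma>\<^sup>2 / (2 * \<alpha>\<^sup>2 * \<beta>) * - (\<alpha>\<^sup>2 * k) + \<sigma>\<^sup>2 / (2 * \<beta>) * (k - \<beta> * (b \<bullet> (M *v b)))"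
    unfolding x transpose_drift_B_mult limit_cov_mult
    by (simp add: inner_stack matrix_vector_mult_diff_distrib matrix_vector_mult_scaleR vec.neg K_AtA_vec KAt k_def inner_diff_right
        del: transpose_matrix_vector)
  ultimately show ?thesis using assms by (simp add: power_mult_distrib field_simps)
qed

text \<open>These are the three inputs on the flow: the deficit from the limiting variance vanishes,
  the mean functional converges, and the negative covariance form is the primitive \<Theta> required
  by \<open>linear_sde_functional_normal\<close>.\<close>

lemma adjoint_flow:
  assumes "0 < \<alpha>" "0 < \<beta>" and \<eta>: "\<And>t. (\<eta> has_vector_derivative (transpose (drift_B \<iota> \<alpha> \<beta>) *v \<eta> t)) (at t)"
  shows "((\<lambda>t. \<eta> t \<bullet> (limit_cov \<alpha> \<beta> \<sigma> *v \<eta> t)) \<longlongrightarrow> 0) at_top"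
    and "((\<lambda>t. \<eta> t \<bullet> stack q (M *v r)) \<longlongrightarrow>
        \<eta> 0 \<bullet> stack (\<chi> i. (\<Sum>n\<in>UNIV. q $ n) / CARD('n)) 0) at_top"
    and "((\<lambda>t. - (\<eta> t \<bullet> (limit_cov \<alpha> \<beta> \<sigma> *v \<eta> t))) has_real_derivative
        (norm (transpose (stack 0 (\<sigma> *\<^sub>R M)) *v \<eta> t))\<^sup>2) (at t)"
proof -
  define a b where "a t = upper (\<eta> t)" and "b t = lower (\<eta> t)" for t
  have \<eta>_eq: "\<eta> t = stack (a t) (b t)" for t by (simp add: a_def b_def)
  have lin: "bounded_linear (upper :: real^('n+'n) \<Rightarrow> real^'n)" "bounded_linear (lower :: real^('n+'n) \<Rightarrow> real^'n)"
    by (auto intro!: linear_conv_bounded_linear[THEN iffD1] linearI simp: vec_eq_iff)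
  have a': "(a has_vector_derivative - (\<alpha>\<^sup>2 *\<^sub>R (A *v b t))) (at t)" for t
    using bounded_linear.has_vector_derivative[OF lin(1) \<eta>, of t] unfolding \<eta>_eq transpose_drift_B_mult
    by (simp add: a_def[abs_def])
  have b': "(b has_vector_derivative transpose A *v a t - \<beta> *\<^sub>R (transpose A *v (A *v b t))) (at t)" for t
    using bounded_linear.has_vector_derivative[OF lin(2) \<eta>, of t] unfolding \<eta>_eq transpose_drift_B_mult
    by (simp add: b_def[abs_def] del: transpose_matrix_vector)
  note decay = adjoint_decay[OF assms(1,2) a' b']
  \<comment> \<open>\<open>K\<close> sees only the centered parts, and these are the ones known to
    decay.\<close>
  have K_form: "v \<bullet> (K *v v) = (M *v v) \<bullet> (K *v (M *v v))" for v
    by (metis K_M inner_K inner_commute)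
  have "((\<lambda>t. \<sigma>\<^sup>2 / (2 * \<alpha>\<^sup>2 * \<beta>) * ((M *v a t) \<bullet> (K *v (M *v a t))) + \<sigma>\<^sup>2 / (2 * \<beta>) * ((M *v b t) \<bullet> (K *v (M *v b t))))
      \<longlongrightarrow> \<sigma>\<^sup>2 / (2 * \<alpha>\<^sup>2 * \<beta>) * (0 \<bullet> (K *v 0)) + \<sigma>\<^sup>2 / (2 * \<beta>) * (0 \<bullet> (K *v 0))) at_top"
    by (intro tendsto_add tendsto_mult_left tendsto_inner decay bounded_linear.tendsto[OF matrix_vector_mul_bounded_linear])
  then show "((\<lambda>t. \<eta> t \<bullet> (limit_cov \<alpha> \<beta> \<sigma> *v \<eta> t)) \<longlongrightarrow> 0) at_top"
    unfolding limit_cov_form a_def[symmetric] b_def[symmetric] by (simp add: K_form[symmetric])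

  \<comment> \<open>The conservation law of the adjoint flow: the derivative of \<open>a\<close>
    lies in the range of \<open>A\<close>, whose elements have sum zero.\<close>
  have sum_a: "(\<Sum>n\<in>UNIV. a t $ n) = (\<Sum>n\<in>UNIV. a 0 $ n)" for t
  proof (rule DERIV_isconst_all[of "\<lambda>t. \<Sum>n\<in>UNIV. a t $ n"], intro allI)
    fix s
    have "((\<lambda>t. a t \<bullet> (\<chi> n. 1)) has_vector_derivative - (\<alpha>\<^sup>2 *\<^sub>R (A *v b s)) \<bullet> (\<chi> n. 1)) (at s)"
      by (rule bounded_linear.has_vector_derivative[OF bounded_linear_inner_left a'])
    moreover have "(A *v b s) \<bullet> (\<chi> n. 1) = 0" using sum_A[of "b s"] by (simp add: inner_vec_def)
    then have "- (\<alpha>\<^sup>2 *\<^sub>R (A *v b s)) \<bullet> (\<chi> n. 1) = 0" by simp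
    moreover have "a t \<bullet> (\<chi> n. 1) = (\<Sum>n\<in>UNIV. a t $ n)" for t by (simp add: inner_vec_def)
    ultimately show "((\<lambda>t. \<Sum>n\<in>UNIV. a t $ n) has_real_derivative 0) (at s)"
      by (simp only: has_real_derivative_iff_has_vector_derivative)
  qed
  have "((\<lambda>t. (M *v a t) \<bullet> q + (\<chi> i. (\<Sum>n\<in>UNIV. a 0 $ n) / CARD('n)) \<bullet> q + (M *v b t) \<bullet> r)
      \<longlongrightarrow> 0 \<bullet> q + (\<chi> i. (\<Sum>n\<in>UNIV. a 0 $ n) / CARD('n)) \<bullet> q + 0 \<bullet> r) at_top"
    by (intro tendsto_intros decay)
  \<comment> \<open>Symmetry of \<open>M\<close> moves the centering from \<open>r\<close> to
    \<open>b t\<close>, so the conserved mean of \<open>b\<close> never enters; only the mean of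
    \<open>a\<close> survives.\<close>
  moreover have "\<eta> t \<bullet> stack q (M *v r) = (M *v a t) \<bullet> q + (\<chi> i. (\<Sum>n\<in>UNIV. a 0 $ n) / CARD('n)) \<bullet> q + (M *v b t) \<bullet> r" for t
  proof -
    have "a t = M *v a t + (\<chi> i. (\<Sum>n\<in>UNIV. a 0 $ n) / CARD('n))"
      using M_decomp[of "a t"] by (simp only: sum_a[of t])
    then have "a t \<bullet> q = (M *v a t) \<bullet> q + (\<chi> i. (\<Sum>n\<in>UNIV. a 0 $ n) / CARD('n)) \<bullet> q"
      by (metis inner_add_left)
    then show ?thesis by (simp add: inner_stack a_def[symmetric] b_def[symmetric] inner_M)
  qed
  moreover have "\<eta> 0 \<bullet> stack (\<chi> i. (\<Sum>n\<in>UNIV. q $ n) / CARD('n)) 0 = (\<chi> i. (\<Sum>n\<in>UNIV. a 0 $ n) / CARD('n)) \<bullet> q"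
    by (simp add: inner_stack a_def[symmetric]) (simp add: inner_vec_def sum_divide_distrib[symmetric] sum_distrib_left[symmetric] sum_distrib_right[symmetric])
  ultimately show "((\<lambda>t. \<eta> t \<bullet> stack q (M *v r)) \<longlongrightarrow>
      \<eta> 0 \<bullet> stack (\<chi> i. (\<Sum>n\<in>UNIV. q $ n) / CARD('n)) 0) at_top"
    by simp

  let ?\<eta>' = "transpose (drift_B \<iota> \<alpha> \<beta>) *v \<eta> t"
  have "((\<lambda>t. \<eta> t \<bullet> (limit_cov \<alpha> \<beta> \<sigma> *v \<eta> t)) has_vector_derivative
      \<eta> t \<bullet> (limit_cov \<alpha> \<beta> \<sigma> *v ?\<eta>') + ?\<eta>' \<bullet> (limit_cov \<alpha> \<beta> \<sigma> *v \<eta> t)) (at t)"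
    by (intro bounded_bilinear.has_vector_derivative[OF bounded_bilinear_inner]
        bounded_linear.has_vector_derivative[OF matrix_vector_mul_bounded_linear] \<eta>)
  moreover have "?\<eta>' \<bullet> (limit_cov \<alpha> \<beta> \<sigma> *v \<eta> t) = \<eta> t \<bullet> (limit_cov \<alpha> \<beta> \<sigma> *v ?\<eta>')"
    by (metis limit_cov_sym dot_lmul_matrix transpose_matrix_vector inner_commute)
  ultimately have "((\<lambda>t. \<eta> t \<bullet> (limit_cov \<alpha> \<beta> \<sigma> *v \<eta> t)) has_real_derivative
      2 * (\<eta> t \<bullet> (limit_cov \<alpha> \<beta> \<sigma> *v ?\<eta>'))) (at t)"
    by (simp add: has_real_derivative_iff_has_vector_derivative)
  then have "((\<lambda>t. \<eta> t \<bullet> (limit_cov \<alpha> \<beta> \<sigma> *v \<eta> t)) has_real_derivative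
      - (norm (transpose (stack 0 (\<sigma> *\<^sub>R M)) *v \<eta> t))\<^sup>2) (at t)"
    by (simp only: limit_cov_lyapunov[OF assms(1,2)])
  from DERIV_minus[OF this] show "((\<lambda>t. - (\<eta> t \<bullet> (limit_cov \<alpha> \<beta> \<sigma> *v \<eta> t))) has_real_derivative
      (norm (transpose (stack 0 (\<sigma> *\<^sub>R M)) *v \<eta> t))\<^sup>2) (at t)"
    by simp
qed

text \<open>At time t the functional \<open>u \<bullet> X t\<close> has the variance of the limit
  minus the same covariance form evaluated at \<eta>(t). The candidate law is built independently of
  the process, and the two are compared through functionals only.\<close>

lemma centered_limit:
  assumes "0 < \<alpha>" "0 < \<beta>" and W: "brownian_motion P W"
    and X: "solves_linear_sde P (drift_B \<iota> \<alpha> \<beta>) (stack 0 (\<sigma> *\<^sub>R M)) W (stack q (M *v r)) X"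
  obtains \<nu> where "normal_law \<nu>" and "mean_vec \<nu> = stack (\<chi> i. (\<Sum>n\<in>UNIV. q $ n) / CARD('n)) 0"
    and "cov_mat \<nu> = limit_cov \<alpha> \<beta> \<sigma>" and "converges_in_distribution P X \<nu>"
proof -
  define B where "B = drift_B \<iota> \<alpha> \<beta>"
  define G :: "real ^ 'n ^ ('n + 'n)" where "G = stack 0 (\<sigma> *\<^sub>R M)"
  define \<Sigma> where "\<Sigma> = limit_cov \<alpha> \<beta> \<sigma>"
  define m :: "real ^ ('n + 'n)" where "m = stack (\<chi> i. (\<Sum>n\<in>UNIV. q $ n) / CARD('n)) 0"
  obtain R :: "real ^ ('n + 'n) ^ ('n + 'n)" where R: "\<And>u. u \<bullet> (\<Sigma> *v u) = (norm (R *v u))\<^sup>2"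
    using limit_cov_sqrt[OF assms(1,2), of \<sigma>] unfolding \<Sigma>_def by blast
  obtain \<nu> :: "(real ^ ('n + 'n)) measure" where \<nu>: "prob_space \<nu>" "sets \<nu> = sets borel"
    and "\<And>u. distr \<nu> borel (\<lambda>x. u \<bullet> x) = normal_real (u \<bullet> m) (norm (transpose (transpose R) *v u))"
    using gaussian_exists[of m "transpose R"] by blast
  then have \<nu>_normal: "distr \<nu> borel (\<lambda>x. u \<bullet> x) = normal_real (u \<bullet> m) (sqrt (u \<bullet> (\<Sigma> *v u)))" for u
    by (simp add: R)
  have "\<exists>\<eta>. \<eta> 0 = u \<and> (\<forall>t. (\<eta> has_vector_derivative (transpose B *v \<eta> t)) (at t))" for u
    using linear_ode_solution_exists[of u "transpose B"] by blast
  then obtain \<eta> where \<eta>0: "\<eta> u 0 = u" and \<eta>: "(\<eta> u has_vector_derivative (transpose B *v \<eta> u t)) (at t)" for u t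
    by metis
  note flow = adjoint_flow(1)[where \<sigma> = \<sigma>, OF assms(1,2) \<eta>[unfolded B_def], folded \<Sigma>_def]
    adjoint_flow(2)[OF assms(1,2) \<eta>[unfolded B_def]]
    adjoint_flow(3)[where \<sigma> = \<sigma>, OF assms(1,2) \<eta>[unfolded B_def], folded \<Sigma>_def G_def]
  have "converges_in_distribution P X \<nu>"
  proof (rule converges_in_distribution_normal[where m = "\<lambda>u t. \<eta> u t \<bullet> stack q (M *v r)"
        and v = "\<lambda>u t. - (\<eta> u t \<bullet> (\<Sigma> *v \<eta> u t)) - - (\<eta> u 0 \<bullet> (\<Sigma> *v \<eta> u 0))"
        and m' = "\<lambda>u. u \<bullet> m" and v' = "\<lambda>u. u \<bullet> (\<Sigma> *v u)"])
    show "prob_space P" using W by (auto simp: brownian_motion_def real_brownian_motion_def)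
    show "X t \<in> borel_measurable P" if "0 < t" for t using X that by (simp add: solves_linear_sde_def)
    show "distr P borel (\<lambda>\<omega>. u \<bullet> X t \<omega>) = normal_real (\<eta> u t \<bullet> stack q (M *v r))
        (sqrt (- (\<eta> u t \<bullet> (\<Sigma> *v \<eta> u t)) - - (\<eta> u 0 \<bullet> (\<Sigma> *v \<eta> u 0))))" if "0 < t" for u t
      using linear_sde_functional_normal[OF W X[folded B_def G_def] that \<eta> flow(3), of u] by (simp add: \<eta>0)
    \<comment> \<open>Nonnegativity follows from monotonicity: the primitive has a square as its
      derivative.\<close>
    show "0 \<le> - (\<eta> u t \<bullet> (\<Sigma> *v \<eta> u t)) - - (\<eta> u 0 \<bullet> (\<Sigma> *v \<eta> u 0))" if "0 < t" for u t
      using DERIV_nonneg_imp_nondecreasing[of 0 t "\<lambda>t. - (\<eta> u t \<bullet> (\<Sigma> *v \<eta> u t))"] flow(3)[of u] that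
      by (auto intro: zero_le_power2)
    show "((\<lambda>t. \<eta> u t \<bullet> stack q (M *v r)) \<longlongrightarrow> u \<bullet> m) at_top" for u
      using flow(2)[of u] by (simp add: m_def \<eta>0)
    have "((\<lambda>t. - (\<eta> u t \<bullet> (\<Sigma> *v \<eta> u t)) - - (\<eta> u 0 \<bullet> (\<Sigma> *v \<eta> u 0))) \<longlongrightarrow> - 0 - - (\<eta> u 0 \<bullet> (\<Sigma> *v \<eta> u 0))) at_top" for u
      by (intro tendsto_intros flow)
    then show "((\<lambda>t. - (\<eta> u t \<bullet> (\<Sigma> *v \<eta> u t)) - - (\<eta> u 0 \<bullet> (\<Sigma> *v \<eta> u 0))) \<longlongrightarrow> u \<bullet> (\<Sigma> *v u)) at_top" for u
      by (simp add: \<eta>0)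
  qed (fact \<nu> \<nu>_normal)+
  moreover have "transpose \<Sigma> = \<Sigma>" by (simp add: \<Sigma>_def limit_cov_sym)
  then have "normal_law \<nu>" "mean_vec \<nu> = m" "cov_mat \<nu> = \<Sigma>"
    using gaussian_moments[OF \<nu> \<nu>_normal] by (simp_all add: R)
  ultimately show thesis using that by (simp add: m_def \<Sigma>_def)
qed

lemma limit_cov_complex:
  "(\<chi> i j. complex_of_real (limit_cov \<alpha> \<beta> \<sigma> $ i $ j)) =
    block_mat ((\<sigma>\<^sup>2 / (2 * \<alpha>\<^sup>2 * \<beta>)) *\<^sub>R mat_K \<iota>) 0 0 ((\<sigma>\<^sup>2 / (2 * \<beta>)) *\<^sub>R mat_K \<iota>)"
proof -
  have "complex_of_real (limit_cov \<alpha> \<beta> \<sigma> $ i $ j) =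
    block_mat ((\<sigma>\<^sup>2 / (2 * \<alpha>\<^sup>2 * \<beta>)) *\<^sub>R mat_K \<iota>) 0 0 ((\<sigma>\<^sup>2 / (2 * \<beta>)) *\<^sub>R mat_K \<iota>) $ i $ j" for i j
    by (cases i; cases j) (simp_all add: limit_cov_def block_mat_def mat_K_eq, simp_all add: scaleR_conv_of_real)
  then show ?thesis by (simp add: vec_eq_iff)
qed

end

theorem theorem3p8:
  fixes \<iota> :: "'n::finite \<Rightarrow> nat"
    and L \<alpha> \<beta> \<sigma> :: real
    and P :: "'w measure"
    and W Q p :: "real \<Rightarrow> 'w \<Rightarrow> real ^ 'n"
    and Q\<^sub>0 p\<^sub>0 :: "real ^ 'n"
  assumes "CARD('n) \<ge> 3" and "bij_betw \<iota> UNIV {1..CARD('n)}"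
    and "L > 0" and "\<alpha> > 0" and "\<beta> > 0"
    and "brownian_motion P W"
    and "\<And>n. Q\<^sub>0 $ n \<ge> 0" and "(\<Sum>n\<in>UNIV. Q\<^sub>0 $ n) = L"
    and "solves_linear_sde P (drift_B \<iota> \<alpha> \<beta>) (diffusion_G \<sigma>) W (stack Q\<^sub>0 p\<^sub>0)
           (\<lambda>t \<omega>. stack (Q t \<omega>) (p t \<omega>))"
  defines "X \<equiv> \<lambda>t \<omega>. stack (Q t \<omega>) (centering_M *v p t \<omega>)"
  shows "solves_linear_sde P (drift_B \<iota> \<alpha> \<beta>) (stack 0 (\<sigma> *\<^sub>R centering_M)) W
           (stack Q\<^sub>0 (centering_M *v p\<^sub>0)) X
       \<and> (\<exists>\<nu>. normal_law \<nu>
            \<and> mean_vec \<nu> = stack ((L / real CARD('n)) *\<^sub>R vec 1) 0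
            \<and> (\<chi> i j. complex_of_real (cov_mat \<nu> $ i $ j)) =
                block_mat ((\<sigma>\<^sup>2 / (2 * \<alpha>\<^sup>2 * \<beta>)) *\<^sub>R mat_K \<iota>) 0
                          0 ((\<sigma>\<^sup>2 / (2 * \<beta>)) *\<^sub>R mat_K \<iota>)
            \<and> converges_in_distribution P X \<nu>)"
proof -
  interpret ring_numbering \<iota> by unfold_locales fact+
  have X: "solves_linear_sde P (drift_B \<iota> \<alpha> \<beta>) (stack 0 (\<sigma> *\<^sub>R centering_M)) W (stack Q\<^sub>0 (centering_M *v p\<^sub>0)) X"
    unfolding X_def by (rule solves_centered) fact
  obtain \<nu> where \<nu>: "normal_law \<nu>" "mean_vec \<nu> = stack (\<chi> i. (\<Sum>n\<in>UNIV. Q\<^sub>0 $ n) / CARD('n)) 0"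
    "cov_mat \<nu> = limit_cov \<alpha> \<beta> \<sigma>" "converges_in_distribution P X \<nu>"
    using centered_limit[OF \<open>\<alpha> > 0\<close> \<open>\<beta> > 0\<close> \<open>brownian_motion P W\<close> X] by blast
  moreover have "(\<chi> i. (\<Sum>n\<in>UNIV. Q\<^sub>0 $ n) / CARD('n)) = (L / real CARD('n)) *\<^sub>R (vec 1 :: real ^ 'n)"
    using \<open>(\<Sum>n\<in>UNIV. Q\<^sub>0 $ n) = L\<close> by (simp add: vec_eq_iff)
  ultimately show ?thesis using X limit_cov_complex by auto
qed

end
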